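(* Let $n\ge1$ and consider learning the Pauli eigenvalues $\boldsymbol\lambda=(\lambda_1,\dots,\lambda_{4^n-1})$ of an $n$-qubit Pauli channel with a maximally entangled probe and Bell measurement, each repetition using the channel once, so that one repetition yields an outcome $x\in\{0,\dots,4^n-1\}$ with probability $$p_{\boldsymbol\lambda}(x)=\frac1{4^n}\sum_{a=0}^{4^n-1}\lambda_a(-1)^{\langle[x]_2,[a]_2\rangle},\qquad \lambda_0=1 .$$ From $M$ independent repetitions, with $n_b$ the number of occurrences of outcome $b$, the maximum-likelihood estimator is $\tilde\lambda^{\mathrm{ML}}_a=\sum_{b=0}^{4^n-1}\frac{n_b}{M}(-1)^{\langle[a]_2,[b]_2\rangle}$. For $\epsilon>0$ and $\delta$ let $N_{\mathrm{samp}}(\epsilon)$ be the smallest positive integer $M_0$ such that for all integers $M\ge M_0$, $\Pr[\|\tilde{\boldsymbol\lambda}^{\mathrm{ML}}-\boldsymbol\lambda\|_2\le\epsilon]\ge1-\delta$ for all $\boldsymbol\lambda$ in the parameter space. Then, with $n,\delta$ fixed and $\epsilon\to0$: (i) for $0<\delta\le1$, $$\limsup_{\epsilon\to0}\frac{N_{\mathrm{samp}}(\epsilon)}{4^{n}\,W_0(8\pi^{-1}\delta^{-2}4^{2n})\,\epsilon^{-2}}\le1 ;$$ (ii) for $0<\delta<1/\sqrt{8\pi e}$, $$\liminf_{\epsilon\to0}\frac{N_{\mathrm{samp}}(\epsilon)}{4^{n-1}\,W_0(\delta^{-2}/8\pi)\,\epsilon^{-2}}\ge1 .$$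
   Context: For $0\le a\le 4^n-1$, $[a]_2=(a_{x,1},\dots,a_{x,n},a_{z,1},\dots,a_{z,n})\in\{0,1\}^{2n}$ is the binary representation of $a$, and $\langle[a]_2,[b]_2\rangle=\sum_{k=1}^n(a_{x,k}b_{z,k}+a_{z,k}b_{x,k})$. An $n$-qubit Pauli channel is $\Lambda(\hat\rho)=\sum_a p_a\hat P_a\hat\rho\hat P_a$, where $\hat P_a$ are the $n$-qubit Pauli operators $\hat P_a=\bigotimes_k i^{a_{x,k}a_{z,k}}\hat X^{a_{x,k}}\hat Z^{a_{z,k}}$ and $(p_a)$ is a probability distribution (Pauli error rates); its Pauli eigenvalues are defined by $\Lambda(\hat P_a)=\lambda_a\hat P_a$ and equal $\lambda_b=\sum_a(-1)^{\langle[a]_2,[b]_2\rangle}p_a$, so that $\lambda_0=1$ and $p_{\boldsymbol\lambda}(x)=p_x$. The parameter space is the set of $\boldsymbol\lambda$ arising from error rates with $p_a>0$ for all $a$ and $\sum_a p_a=1$. $\|\cdot\|_2$ is the Euclidean norm on $\mathbb R^{4^n-1}$. $W_0$ is the principal branch of the Lambert $W$ function. The sample complexity equals the number of repetitions because each repetition uses the channel once. *)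

theory Defs
  imports
    "HOL-Probability.Probability"
    "Jordan_Normal_Form.Matrix"
begin

text \<open>
  \<^const>\<open>bit\<close> counts from the least significant digit, whereas the string
  \<open>(a\<^sub>x\<^sub>,\<^sub>1, \<dots>, a\<^sub>x\<^sub>,\<^sub>n, a\<^sub>z\<^sub>,\<^sub>1, \<dots>, a\<^sub>z\<^sub>,\<^sub>n)\<close> is written with the most significant digit
  first. The qubit index \<open>k\<close> ranges over \<open>1, \<dots>, n\<close>.
\<close>

definition xbit :: "nat \<Rightarrow> nat \<Rightarrow> nat \<Rightarrow> nat" where
  "xbit n a k = of_bool (bit a (2 * n - k))"

definition zbit :: "nat \<Rightarrow> nat \<Rightarrow> nat \<Rightarrow> nat" where
  "zbit n a k = of_bool (bit a (n - k))"

definition symp :: "nat \<Rightarrow> nat \<Rightarrow> nat \<Rightarrow> nat" where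
  "symp n a b = (\<Sum>k=1..n. xbit n a k * zbit n b k + zbit n a k * xbit n b k)"

definition pauli_X :: "complex Matrix.mat" where
  "pauli_X = mat_of_rows_list 2 [[0, 1], [1, 0]]"

definition pauli_Z :: "complex Matrix.mat" where
  "pauli_Z = mat_of_rows_list 2 [[1, 0], [0, -1]]"

definition kron :: "'a::times Matrix.mat \<Rightarrow> 'a Matrix.mat \<Rightarrow> 'a Matrix.mat" where
  "kron A B = Matrix.mat (dim_row A * dim_row B) (dim_col A * dim_col B)
     (\<lambda>(i, j). A $$ (i div dim_row B, j div dim_col B) * B $$ (i mod dim_row B, j mod dim_col B))"

definition pauli_op :: "nat \<Rightarrow> nat \<Rightarrow> complex Matrix.mat" where
  "pauli_op n a =
     foldr kron
       (map (\<lambda>k. \<i> ^ (xbit n a k * zbit n a k) \<cdot>\<^sub>m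
                  (pauli_X ^\<^sub>m xbit n a k * pauli_Z ^\<^sub>m zbit n a k)) [1..<n + 1])
       (1\<^sub>m 1)"

text \<open>
  Matrices of varying dimension do not form a type-class monoid, so the sum over
  the \<open>4 ^ n\<close> error terms is taken entrywise.
\<close>

definition pauli_channel :: "nat \<Rightarrow> (nat \<Rightarrow> real) \<Rightarrow> complex Matrix.mat \<Rightarrow> complex Matrix.mat" where
  "pauli_channel n p \<rho> =
     Matrix.mat (2 ^ n) (2 ^ n)
       (\<lambda>ij. \<Sum>a<4 ^ n. complex_of_real (p a) * (pauli_op n a * \<rho> * pauli_op n a) $$ ij)"

definition pauli_eigenvalues :: "nat \<Rightarrow> (nat \<Rightarrow> real) \<Rightarrow> (nat \<Rightarrow> real) \<Rightarrow> bool" where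
  "pauli_eigenvalues n p l \<longleftrightarrow>
     (\<forall>a<4 ^ n. pauli_channel n p (pauli_op n a) = complex_of_real (l a) \<cdot>\<^sub>m pauli_op n a)"

text \<open>
  Only the values at indices below \<open>4 ^ n\<close> matter. Index \<open>0\<close> is included, and its
  eigenvalue equation says \<open>l 0 = 1\<close> because \<open>pauli_op n 0\<close> is the identity.
\<close>

definition param_space :: "nat \<Rightarrow> (nat \<Rightarrow> real) set" where
  "param_space n =
     {l. \<exists>p. (\<forall>a<4 ^ n. p a > 0) \<and> (\<Sum>a<4 ^ n. p a) = 1 \<and> pauli_eigenvalues n p l}"

definition outcome_prob :: "nat \<Rightarrow> (nat \<Rightarrow> real) \<Rightarrow> nat \<Rightarrow> real" where
  "outcome_prob n l x = 1 / 4 ^ n * (\<Sum>a<4 ^ n. l a * (-1) ^ symp n x a)"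

text \<open>For \<open>l\<close> in \<open>param_space n\<close> the embedded function is nonnegative with total mass one.\<close>

definition outcome_pmf :: "nat \<Rightarrow> (nat \<Rightarrow> real) \<Rightarrow> nat pmf" where
  "outcome_pmf n l = embed_pmf (\<lambda>x. if x < 4 ^ n then outcome_prob n l x else 0)"

definition repetitions_pmf :: "nat \<Rightarrow> (nat \<Rightarrow> real) \<Rightarrow> nat \<Rightarrow> (nat \<Rightarrow> nat) pmf" where
  "repetitions_pmf n l M = Pi_pmf {..<M} 0 (\<lambda>_. outcome_pmf n l)"

definition occurrences :: "nat \<Rightarrow> (nat \<Rightarrow> nat) \<Rightarrow> nat \<Rightarrow> nat" where
  "occurrences M \<omega> b = card {i. i < M \<and> \<omega> i = b}"

definition ml_estimator :: "nat \<Rightarrow> nat \<Rightarrow> (nat \<Rightarrow> nat) \<Rightarrow> nat \<Rightarrow> real" where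
  "ml_estimator n M \<omega> a =
     (\<Sum>b<4 ^ n. real (occurrences M \<omega> b) / real M * (-1) ^ symp n a b)"

definition success_prob :: "nat \<Rightarrow> (nat \<Rightarrow> real) \<Rightarrow> nat \<Rightarrow> real \<Rightarrow> real" where
  "success_prob n l M \<epsilon> =
     measure_pmf.prob (repetitions_pmf n l M)
       {\<omega>. L2_set (\<lambda>a. ml_estimator n M \<omega> a - l a) {1..4 ^ n - 1} \<le> \<epsilon>}"

definition N_samp :: "nat \<Rightarrow> real \<Rightarrow> real \<Rightarrow> nat" where
  "N_samp n \<delta> \<epsilon> =
     (LEAST M0. M0 \<ge> 1 \<and> (\<forall>M\<ge>M0. \<forall>l\<in>param_space n. success_prob n l M \<epsilon> \<ge> 1 - \<delta>))"

text \<open>Principal branch of the Lambert W function, for arguments \<open>x \<ge> - exp (- 1)\<close>.\<close>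

definition lambert_W0 :: "real \<Rightarrow> real" where
  "lambert_W0 x = (THE w. w \<ge> -1 \<and> w * exp w = x)"

end

theory Submission
  imports Defs "HOL-Real_Asymp.Real_Asymp"
begin

text \<open>
  The characters \<open>(-1) ^ symp n a b\<close> are orthogonal, so by Parseval the error of the estimator is
  \<open>2 ^ n\<close> times the Euclidean distance between the empirical outcome frequencies and the error
  rates. That distance has mean at most \<open>1 / sqrt M\<close> and changes by at most \<open>sqrt 2 / M\<close> when one
  outcome is replaced, so McDiarmid's inequality bounds the failure probability by
  \<open>exp (- (sqrt t - 1)\<^sup>2)\<close> with \<open>t = M * \<epsilon>\<^sup>2 / 4 ^ n\<close>; this is at most \<open>\<delta>\<close> as soon as \<open>t\<close> reaches the
  Lambert value in (i), without any limit in \<open>\<epsilon>\<close>.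

  For (ii), take error rates giving the trivial outcome probability \<open>1 / 2\<close>. A single frequency that
  deviates by more than \<open>\<epsilon> / 2 ^ n\<close> already makes the estimate fail, and for
  \<open>M = \<lfloor>4 ^ (n - 1) * W / \<epsilon>\<^sup>2\<rfloor>\<close> the central limit theorem bounds the probability of this from below by
  the Gaussian tail at \<open>sqrt W\<close>. By the Mills ratio bound that tail strictly exceeds
  \<open>exp (- W / 2) / sqrt (8 * pi * W) = \<delta>\<close> when \<open>W > 1\<close>, which is the condition on \<open>\<delta>\<close>.
\<close>

section \<open>Bounded differences for independent samples\<close>

abbreviation iid_pmf :: "nat \<Rightarrow> 'a \<Rightarrow> 'a pmf \<Rightarrow> (nat \<Rightarrow> 'a) pmf" where
  "iid_pmf m d q \<equiv> Pi_pmf {..<m} d (\<lambda>_. q)"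

lemma finite_set_Pi_pmf:
  assumes "finite I" "\<And>i. i \<in> I \<Longrightarrow> finite (set_pmf (q i))"
  shows "finite (set_pmf (Pi_pmf I d q))"
  using assms by (subst set_Pi_pmf) (auto intro!: finite_PiE_dflt)

text \<open>Drawing the last coordinate after the others turns an expectation over
  \<open>Suc m\<close> samples into an iterated one. Both inductions on the sample size below rest
  on this; finite support makes every function integrable.\<close>

lemma expectation_Pi_pmf_Suc:
  fixes f :: "(nat \<Rightarrow> 'a) \<Rightarrow> real"
  assumes q: "finite (set_pmf q)"
  shows "measure_pmf.expectation (iid_pmf (Suc m) d q) f =
    measure_pmf.expectation (iid_pmf m d q)
      (\<lambda>w. measure_pmf.expectation q (\<lambda>x. f (w(m := x))))"
proof -
  let ?P = "iid_pmf m d q"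
  have fin: "finite (set_pmf ?P)"
    using q by (intro finite_set_Pi_pmf) auto
  have "iid_pmf (Suc m) d q = ?P \<bind> (\<lambda>w. map_pmf (\<lambda>x. w(m := x)) q)"
    unfolding lessThan_Suc map_pmf_def
    by (subst Pi_pmf_insert') (auto intro: bind_commute_pmf)
  then have "measure_pmf.expectation (iid_pmf (Suc m) d q) f =
      (\<Sum>w\<in>set_pmf ?P. pmf ?P w *\<^sub>R measure_pmf.expectation (map_pmf (\<lambda>x. w(m := x)) q) f)"
    using q fin by (simp only:) (rule pmf_expectation_bind, auto)
  also have "\<dots> = measure_pmf.expectation ?P
      (\<lambda>w. measure_pmf.expectation q (\<lambda>x. f (w(m := x))))"
    using fin by (subst integral_measure_pmf[of "set_pmf ?P"]) auto
  finally show ?thesis .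
qed

text \<open>Hoeffding's lemma in uncentred form, with the range of \<open>f\<close> replaced by a
  bound on its oscillation, which is what a bounded-difference hypothesis supplies for one
  coordinate.\<close>

lemma hoeffding_lemma_pmf:
  fixes f :: "'a \<Rightarrow> real"
  assumes q: "finite (set_pmf q)" and s: "s > 0"
    and c: "\<And>x y. \<bar>f x - f y\<bar> \<le> c"
  shows "measure_pmf.expectation q (\<lambda>x. exp (s * f x))
    \<le> exp (s * measure_pmf.expectation q f + s\<^sup>2 * c\<^sup>2 / 8)"
proof -
  define a where "a = Min (f ` set_pmf q)"
  define b where "b = Max (f ` set_pmf q)"
  have ne: "f ` set_pmf q \<noteq> {}" "finite (f ` set_pmf q)"
    using q set_pmf_not_empty by auto
  interpret interval_bounded_random_variable "measure_pmf q" f a b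
    by unfold_locales (use ne in \<open>auto simp: a_def b_def AE_measure_pmf_iff\<close>)
  let ?\<mu> = "measure_pmf.expectation q f"
  have int: "integrable (measure_pmf q) g" for g :: "'a \<Rightarrow> real"
    using q by (rule integrable_measure_pmf_finite)
  have "ennreal (measure_pmf.expectation q (\<lambda>x. exp (s * (f x - ?\<mu>)))) =
      nn_integral (measure_pmf q) (\<lambda>x. exp (s * (f x - ?\<mu>)))"
    by (intro nn_integral_eq_integral[symmetric] int) auto
  also have "\<dots> \<le> ennreal (exp (s\<^sup>2 * (b - a)\<^sup>2 / 8))"
    by (rule Hoeffdings_lemma_nn_integral[OF s])
  finally have *: "measure_pmf.expectation q (\<lambda>x. exp (s * (f x - ?\<mu>))) \<le> exp (s\<^sup>2 * (b - a)\<^sup>2 / 8)"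
    by simp
  \<comment> \<open>On a finite support both extremes are attained, so \<open>c\<close> bounds
    \<open>b - a\<close>.\<close>
  have "b \<in> f ` set_pmf q" "a \<in> f ` set_pmf q"
    using ne by (auto simp: a_def b_def)
  with c have "\<bar>b - a\<bar> \<le> c" by auto
  then have "(b - a)\<^sup>2 \<le> c\<^sup>2"
    by (simp add: abs_le_square_iff[symmetric])
  then have "exp (s\<^sup>2 * (b - a)\<^sup>2 / 8) \<le> exp (s\<^sup>2 * c\<^sup>2 / 8)"
    by (simp add: mult_left_mono)
  with * have "measure_pmf.expectation q (\<lambda>x. exp (s * (f x - ?\<mu>))) \<le> exp (s\<^sup>2 * c\<^sup>2 / 8)"
    by linarith
  then have "exp (s * ?\<mu>) * measure_pmf.expectation q (\<lambda>x. exp (s * (f x - ?\<mu>)))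
      \<le> exp (s * ?\<mu>) * exp (s\<^sup>2 * c\<^sup>2 / 8)"
    by simp
  moreover have "exp (s * ?\<mu>) * measure_pmf.expectation q (\<lambda>x. exp (s * (f x - ?\<mu>)))
      = measure_pmf.expectation q (\<lambda>x. exp (s * f x))"
    by (subst integral_mult_right_zero[symmetric])
       (simp add: exp_add[symmetric] algebra_simps)
  ultimately show ?thesis by (simp add: exp_add)
qed

text \<open>Given the first \<open>m\<close> samples, Hoeffding's lemma costs a factor
  \<open>exp (s\<^sup>2 * c\<^sup>2 / 8)\<close> for the last one. Averaging over the last one
  leaves a function of the first \<open>m\<close> to which the induction hypothesis applies.\<close>

lemma bounded_differences_mgf:
  fixes f :: "(nat \<Rightarrow> 'a) \<Rightarrow> real"
  assumes q: "finite (set_pmf q)" and s: "s > 0"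
    and c: "\<And>w i x y. i < m \<Longrightarrow> \<bar>f (w(i := x)) - f (w(i := y))\<bar> \<le> c"
  shows "measure_pmf.expectation (iid_pmf m d q) (\<lambda>w. exp (s * f w))
    \<le> exp (s * measure_pmf.expectation (iid_pmf m d q) f + real m * (s\<^sup>2 * c\<^sup>2 / 8))"
  using c
proof (induction m arbitrary: f)
  case 0
  then show ?case by simp
next
  case (Suc m)
  let ?P = "iid_pmf m d q"
  let ?K = "s\<^sup>2 * c\<^sup>2 / 8"
  define g where "g w = measure_pmf.expectation q (\<lambda>x. f (w(m := x)))" for w
  have int: "integrable (measure_pmf q) h" for h :: "'a \<Rightarrow> real"
    using q by (rule integrable_measure_pmf_finite)
  have intP: "integrable (measure_pmf ?P) h" for h :: "_ \<Rightarrow> real"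
    using q by (intro integrable_measure_pmf_finite finite_set_Pi_pmf) auto
  \<comment> \<open>Averaging over coordinate \<open>m\<close> keeps the differences bounded by
    \<open>c\<close>, since updates at \<open>i\<close> and \<open>m\<close> commute.\<close>
  have g: "\<bar>g (w(i := x)) - g (w(i := y))\<bar> \<le> c" if "i < m" for w i x y
  proof -
    have "g (w(i := x)) - g (w(i := y)) =
        measure_pmf.expectation q (\<lambda>z. f ((w(m := z))(i := x)) - f ((w(m := z))(i := y)))"
      unfolding g_def using that by (subst Bochner_Integration.integral_diff) (auto simp: int fun_upd_twist)
    also have "\<bar>\<dots>\<bar> \<le> measure_pmf.expectation q (\<lambda>z. \<bar>f ((w(m := z))(i := x)) - f ((w(m := z))(i := y))\<bar>)"
      by (rule integral_abs_bound)
    also have "\<dots> \<le> measure_pmf.expectation q (\<lambda>z. c)"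
      by (intro integral_mono int Suc.prems less_SucI that)
    finally show ?thesis by simp
  qed
  have "measure_pmf.expectation (iid_pmf (Suc m) d q) (\<lambda>w. exp (s * f w)) =
      measure_pmf.expectation ?P (\<lambda>w. measure_pmf.expectation q (\<lambda>x. exp (s * f (w(m := x)))))"
    by (rule expectation_Pi_pmf_Suc[OF q])
  also have "\<dots> \<le> measure_pmf.expectation ?P (\<lambda>w. exp (s * g w) * exp ?K)"
    by (intro integral_mono intP)
       (unfold g_def exp_add[symmetric], intro hoeffding_lemma_pmf q s Suc.prems, simp)
  also have "\<dots> \<le> exp (s * measure_pmf.expectation ?P g + real m * ?K) * exp ?K"
    using Suc.IH[of g, OF g] by simp
  also have "\<dots> = exp (s * measure_pmf.expectation ?P g + real (Suc m) * ?K)"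
    by (simp add: exp_add[symmetric] algebra_simps add_divide_distrib)
  also have "measure_pmf.expectation ?P g = measure_pmf.expectation (iid_pmf (Suc m) d q) f"
    unfolding g_def by (rule expectation_Pi_pmf_Suc[OF q, symmetric])
  finally show ?case .
qed

lemma mcdiarmid_Pi_pmf:
  fixes f :: "(nat \<Rightarrow> 'a) \<Rightarrow> real"
  assumes q: "finite (set_pmf q)" and m: "m > 0" and cpos: "c > 0"
    and c: "\<And>w i x y. i < m \<Longrightarrow> \<bar>f (w(i := x)) - f (w(i := y))\<bar> \<le> c"
    and r: "r \<ge> 0"
  shows "measure_pmf.prob (iid_pmf m d q) {w. f w > measure_pmf.expectation (iid_pmf m d q) f + r}
    \<le> exp (- 2 * r\<^sup>2 / (real m * c\<^sup>2))"
\<comment> \<open>For \<open>r = 0\<close> the bound is \<open>1\<close>; the Chernoff argument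
  requires a strictly positive \<open>s\<close>.\<close>
proof (cases "r = 0")
  case True
  then show ?thesis by simp
next
  case False
  let ?P = "iid_pmf m d q"
  let ?\<mu> = "measure_pmf.expectation ?P f"
  \<comment> \<open>The minimiser of the exponent
    \<open>m * s\<^sup>2 * c\<^sup>2 / 8 - s * r\<close>.\<close>
  define s where "s = 4 * r / (real m * c\<^sup>2)"
  have s: "s > 0" using False r m cpos by (simp add: s_def)
  have intP: "integrable (measure_pmf ?P) h" for h :: "_ \<Rightarrow> real"
    using q by (intro integrable_measure_pmf_finite finite_set_Pi_pmf) auto
  have "measure_pmf.prob ?P {w. f w > ?\<mu> + r} \<le>
      measure_pmf.prob ?P {w\<in>space ?P. exp (s * f w) \<ge> exp (s * (?\<mu> + r))}"
    using s by (intro measure_pmf.finite_measure_mono) auto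
  also have "\<dots> \<le> measure_pmf.expectation ?P (\<lambda>w. exp (s * f w)) / exp (s * (?\<mu> + r))"
    by (rule integral_Markov_inequality_measure[OF intP, where A = "{}"]) auto
  also have "\<dots> \<le> exp (s * ?\<mu> + real m * (s\<^sup>2 * c\<^sup>2 / 8)) / exp (s * (?\<mu> + r))"
    by (intro divide_right_mono bounded_differences_mgf q s c) auto
  also have "\<dots> = exp (real m * (s\<^sup>2 * c\<^sup>2 / 8) - s * r)"
    by (simp add: exp_diff[symmetric] algebra_simps)
  also have "real m * (s\<^sup>2 * c\<^sup>2 / 8) - s * r = - 2 * r\<^sup>2 / (real m * c\<^sup>2)"
    using m cpos by (simp add: s_def field_simps power2_eq_square)
  finally show ?thesis .
qed

text \<open>In each induction step the cross term of the square is linear in the new centred sample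
  and so has mean zero.\<close>

lemma expectation_square_sum_Pi_pmf:
  fixes h :: "'a \<Rightarrow> real"
  assumes q: "finite (set_pmf q)" and h: "measure_pmf.expectation q h = 0"
  shows "measure_pmf.expectation (iid_pmf m d q) (\<lambda>w. (\<Sum>i<m. h (w i))\<^sup>2) =
    real m * measure_pmf.expectation q (\<lambda>x. (h x)\<^sup>2)"
proof (induction m)
  case 0
  then show ?case by simp
next
  case (Suc m)
  have int: "integrable (measure_pmf q) k" for k :: "'a \<Rightarrow> real"
    using q by (rule integrable_measure_pmf_finite)
  have intP: "integrable (measure_pmf (iid_pmf m d q)) k" for k :: "_ \<Rightarrow> real"
    using q by (intro integrable_measure_pmf_finite finite_set_Pi_pmf) auto
  have "measure_pmf.expectation q (\<lambda>x. (\<Sum>i<Suc m. h ((w(m := x)) i))\<^sup>2) =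
      (\<Sum>i<m. h (w i))\<^sup>2 + measure_pmf.expectation q (\<lambda>x. (h x)\<^sup>2)" for w
  proof -
    let ?S = "\<Sum>i<m. h (w i)"
    have "(\<Sum>i<Suc m. h ((w(m := x)) i))\<^sup>2 = ?S\<^sup>2 + 2 * ?S * h x + (h x)\<^sup>2" for x
      by (simp add: power2_sum)
    then show ?thesis by (simp add: int h)
  qed
  then show ?case
    by (subst expectation_Pi_pmf_Suc[OF q]) (simp add: intP Suc.IH algebra_simps)
qed

lemma expectation_le_sqrt_expectation_square:
  fixes f :: "'a \<Rightarrow> real"
  assumes "finite (set_pmf q)"
  shows "measure_pmf.expectation q f \<le> sqrt (measure_pmf.expectation q (\<lambda>x. (f x)\<^sup>2))"
proof -
  have int: "integrable (measure_pmf q) k" for k :: "'a \<Rightarrow> real"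
    using assms by (rule integrable_measure_pmf_finite)
  have "0 \<le> measure_pmf.variance q f"
    by (rule measure_pmf.variance_positive)
  also have "\<dots> = measure_pmf.expectation q (\<lambda>x. (f x)\<^sup>2) - (measure_pmf.expectation q f)\<^sup>2"
    by (rule measure_pmf.variance_eq) (auto intro: int)
  finally show ?thesis by (intro real_le_rsqrt) simp
qed

section \<open>Pauli eigenvalues and symplectic characters\<close>

text \<open>The characters of the group of bit strings of length \<open>2 * n\<close>, indexed
  through the symplectic form. This indexing is symmetric, so the transform they define is its own
  inverse up to the factor \<open>4 ^ n\<close>.\<close>

definition chi :: "nat \<Rightarrow> nat \<Rightarrow> nat \<Rightarrow> real" where
  "chi n a b = (-1) ^ symp n a b"

lemma symp_commute: "symp n a b = symp n b a"
  unfolding symp_def by (intro sum.cong) auto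

lemma chi_commute: "chi n a b = chi n b a"
  by (simp add: chi_def symp_commute)

lemma chi_square [simp]: "chi n a b * chi n a b = 1"
  by (simp add: chi_def flip: power_add)

lemma chi_0 [simp]: "chi n 0 b = 1"
  by (simp add: chi_def symp_def xbit_def zbit_def)

lemma chi_eq_prod:
  "chi n a b = (\<Prod>k=1..n. (-1) ^ (xbit n a k * zbit n b k) * (-1) ^ (zbit n a k * xbit n b k))"
  by (simp add: chi_def symp_def power_sum power_add)

definition partner_bit :: "nat \<Rightarrow> nat \<Rightarrow> nat" where
  "partner_bit n j = (if j < n then j + n else j - n)"

text \<open>The symplectic form pairs bit \<open>j\<close> of one argument with bit \<open>j \<plusminus> n\<close> of the other.\<close>

lemma chi_eq_prod_bits:
  "chi n a b = (\<Prod>j<2*n. if bit a j \<and> bit b (partner_bit n j) then -1 else 1)"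
proof -
  let ?f = "\<lambda>j. if bit a j \<and> bit b (partner_bit n j) then -1 else (1::real)"
  \<comment> \<open>The x bit of qubit \<open>k\<close> sits at position \<open>2*n - k\<close>, in
    the upper half, and its z partner at \<open>n - k\<close>.\<close>
  have x: "(\<Prod>k=1..n. (-1) ^ (xbit n a k * zbit n b k)) = prod ?f {n..<2*n}"
    by (intro prod.reindex_bij_witness[of _ "\<lambda>j. 2*n - j" "\<lambda>k. 2*n - k"])
       (auto simp: xbit_def zbit_def partner_bit_def)
  have z: "(\<Prod>k=1..n. (-1) ^ (zbit n a k * xbit n b k)) = prod ?f {..<n}"
    by (intro prod.reindex_bij_witness[of _ "\<lambda>j. n - j" "\<lambda>k. n - k"])
       (auto simp: xbit_def zbit_def partner_bit_def mult_2)
  have "{..<2*n} = {n..<2*n} \<union> {..<n}" by auto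
  moreover have "prod ?f ({n..<2*n} \<union> {..<n}) = prod ?f {n..<2*n} * prod ?f {..<n}"
    by (rule prod.union_disjoint) auto
  ultimately have "prod ?f {..<2*n} = prod ?f {n..<2*n} * prod ?f {..<n}"
    by simp
  then show ?thesis
    by (simp only: chi_eq_prod prod.distrib x z)
qed

text \<open>\<open>partner_bit n\<close> is injective on the positions below \<open>2 * n\<close>,
  so only factor \<open>j\<close> of the product reads the flipped bit.\<close>

lemma chi_flip_bit:
  assumes "j < 2 * n"
  shows "chi n a (flip_bit (partner_bit n j) b) = (if bit a j then - chi n a b else chi n a b)"
proof -
  have part: "partner_bit n i \<noteq> partner_bit n j" if "i < 2 * n" "i \<noteq> j" for i
    using that assms by (auto simp: partner_bit_def split: if_splits)
  have other: "(\<Prod>i\<in>{..<2*n}-{j}. if bit a i \<and> bit (flip_bit (partner_bit n j) b) (partner_bit n i) then -1 else (1::real))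
    = (\<Prod>i\<in>{..<2*n}-{j}. if bit a i \<and> bit b (partner_bit n i) then -1 else 1)"
    by (intro prod.cong refl) (use part in \<open>fastforce simp: bit_flip_bit_iff\<close>)
  show ?thesis
    unfolding chi_eq_prod_bits
    using assms
    by (subst (1 2 3) prod.remove[of "{..<2*n}" j]) (simp_all only: other, auto simp: bit_flip_bit_iff)
qed

lemma flip_bit_less_power:
  fixes a :: nat
  assumes "a < 2 ^ m" "j < m"
  shows "flip_bit j a < 2 ^ m"
proof -
  have "take_bit m (flip_bit j a) = flip_bit j a"
    using assms by (simp add: take_bit_flip_bit_eq take_bit_nat_eq_self)
  then show ?thesis by (simp add: take_bit_nat_eq_self_iff)
qed

lemma ex_bit_neq_if_less_power:
  fixes a b :: nat
  assumes "a < 2 ^ m" "b < 2 ^ m" "a \<noteq> b"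
  obtains j where "j < m" "bit a j \<noteq> bit b j"
proof -
  from assms(3) obtain j where j: "bit a j \<noteq> bit b j"
    by (auto simp: bit_eq_iff)
  have "take_bit m a = a" "take_bit m b = b"
    using assms by (simp_all add: take_bit_nat_eq_self)
  with j have "j < m"
    by (metis bit_take_bit_iff)
  with j that show ?thesis by blast
qed

text \<open>If \<open>b\<close> and \<open>c\<close> differ at bit \<open>j\<close>, flipping the
  partner of \<open>j\<close> in \<open>a\<close> negates exactly one of the two characters. This
  involution of the index set shows that the sum equals its own negative.\<close>

lemma chi_orthogonal:
  assumes "b < 4 ^ n" "c < 4 ^ n"
  shows "(\<Sum>a<4^n. chi n a b * chi n a c) = (if b = c then 4 ^ n else 0)"
proof (cases "b = c")
  case True
  then show ?thesis by simp
next
  case False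
  have pow: "(4::nat) ^ n = 2 ^ (2 * n)" by (simp add: power_mult)
  obtain j where j: "j < 2 * n" "bit b j \<noteq> bit c j"
    using assms False ex_bit_neq_if_less_power unfolding pow by metis
  let ?F = "flip_bit (partner_bit n j) :: nat \<Rightarrow> nat"
  have pj: "partner_bit n j < 2 * n"
    using j by (auto simp: partner_bit_def)
  have inv: "?F (?F a) = a" for a
    by (auto simp: bit_eq_iff bit_flip_bit_iff)
  have neg: "chi n (?F a) b * chi n (?F a) c = - (chi n a b * chi n a c)" for a
    using j by (simp add: chi_commute[of n _ b] chi_commute[of n _ c] chi_flip_bit)
  have "(\<Sum>a<4^n. chi n a b * chi n a c) = (\<Sum>a<4^n. chi n (?F a) b * chi n (?F a) c)"
    by (rule sum.reindex_bij_witness[of _ ?F ?F])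
       (auto simp: inv pow flip_bit_less_power pj)
  also have "\<dots> = - (\<Sum>a<4^n. chi n a b * chi n a c)"
    by (simp add: neg sum_negf)
  finally show ?thesis using False by simp
qed

lemma chi_inversion:
  assumes "x < 4 ^ n"
  shows "(\<Sum>a<4^n. chi n x a * (\<Sum>b<4^n. chi n a b * f b)) = 4 ^ n * f x"
proof -
  have "(\<Sum>a<4^n. chi n x a * (\<Sum>b<4^n. chi n a b * f b)) =
      (\<Sum>b<4^n. f b * (\<Sum>a<4^n. chi n a x * chi n a b))"
    unfolding sum_distrib_left
    by (subst sum.swap) (simp add: chi_commute[of n x] mult_ac)
  also have "\<dots> = (\<Sum>b<4^n. f b * (if x = b then 4 ^ n else 0))"
    using assms by (intro sum.cong refl) (simp add: chi_orthogonal)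
  also have "\<dots> = 4 ^ n * f x"
    using assms by (simp add: if_distrib[of "(*) _"] sum.delta cong: if_cong)
  finally show ?thesis .
qed

text \<open>Expanding only one of the two factors of the square leaves the double transform of
  \<open>f\<close>, which \<open>chi_inversion\<close> evaluates.\<close>

lemma chi_parseval:
  "(\<Sum>a<4^n. (\<Sum>b<4^n. chi n a b * f b)\<^sup>2) = 4 ^ n * (\<Sum>b<4^n. (f b)\<^sup>2)"
proof -
  have "(\<Sum>a<4^n. (\<Sum>b<4^n. chi n a b * f b)\<^sup>2) =
      (\<Sum>a<4^n. \<Sum>x<4^n. f x * (chi n x a * (\<Sum>b<4^n. chi n a b * f b)))"
    by (intro sum.cong refl, unfold power2_eq_square, subst sum_distrib_right)
       (auto intro!: sum.cong simp: chi_commute mult_ac)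
  also have "\<dots> = (\<Sum>x<4^n. f x * (\<Sum>a<4^n. chi n x a * (\<Sum>b<4^n. chi n a b * f b)))"
    by (subst sum.swap) (simp only: sum_distrib_left)
  also have "\<dots> = (\<Sum>x<4^n. f x * (4 ^ n * f x))"
    by (intro sum.cong refl) (simp add: chi_inversion)
  also have "\<dots> = 4 ^ n * (\<Sum>b<4^n. (f b)\<^sup>2)"
    by (simp add: sum_distrib_left power2_eq_square mult_ac)
  finally show ?thesis .
qed

section \<open>Kronecker products and conjugation by Pauli operators\<close>

lemma sum_divmod:
  fixes f :: "nat \<Rightarrow> nat \<Rightarrow> 'a::comm_monoid_add"
  shows "(\<Sum>k<s * v. f (k div v) (k mod v)) = (\<Sum>i<s. \<Sum>j<v. f i j)"
proof (cases "v = 0")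
  case True
  then show ?thesis by simp
next
  case False
  have "(\<Sum>k<s * v. f (k div v) (k mod v)) = (\<Sum>(i,j)\<in>{..<s}\<times>{..<v}. f i j)"
  proof (rule sum.reindex_bij_witness[of _ "\<lambda>(i,j). i * v + j" "\<lambda>k. (k div v, k mod v)"])
    fix ij assume "ij \<in> {..<s} \<times> {..<v}"
    then obtain i j where ij: "ij = (i, j)" "i < s" "j < v" by auto
    have "i * v + j < (i + 1) * v" using ij by simp
    also have "\<dots> \<le> s * v" using ij by (intro mult_right_mono) auto
    finally show "(case ij of (i, j) \<Rightarrow> i * v + j) \<in> {..<s * v}" using ij by simp
  qed (use False in \<open>auto simp: less_mult_imp_div_less\<close>)
  then show ?thesis by (simp add: sum.cartesian_product)
qed

lemma dim_kron [simp]: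
  "dim_row (kron A B) = dim_row A * dim_row B" "dim_col (kron A B) = dim_col A * dim_col B"
  by (simp_all add: kron_def)

lemma index_kron:
  "i < dim_row A * dim_row B \<Longrightarrow> j < dim_col A * dim_col B \<Longrightarrow>
    kron A B $$ (i, j) = A $$ (i div dim_row B, j div dim_col B) * B $$ (i mod dim_row B, j mod dim_col B)"
  by (simp add: kron_def)

text \<open>The mixed-product rule: splitting the summation index by \<open>div\<close> and
  \<open>mod\<close> factors the double sum.\<close>

lemma kron_mult:
  fixes A :: "'a::comm_semiring_0 Matrix.mat"
  assumes "dim_col A = dim_row C" "dim_col B = dim_row D"
  shows "kron A B * kron C D = kron (A * C) (B * D)"
proof (rule eq_matI)
  fix i j assume ij: "i < dim_row (kron (A * C) (B * D))" "j < dim_col (kron (A * C) (B * D))"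
  let ?i1 = "i div dim_row B" and ?i2 = "i mod dim_row B"
  let ?j1 = "j div dim_col D" and ?j2 = "j mod dim_col D"
  have pos: "dim_row B > 0" "dim_col D > 0"
    using ij by (auto intro!: gr0I)
  have lt: "?i1 < dim_row A" "?i2 < dim_row B" "?j1 < dim_col C" "?j2 < dim_col D"
    using ij pos by (auto simp: less_mult_imp_div_less)
  have "(kron A B * kron C D) $$ (i, j) =
      (\<Sum>k<dim_row C * dim_row D. (A $$ (?i1, k div dim_row D) * B $$ (?i2, k mod dim_row D)) *
        (C $$ (k div dim_row D, ?j1) * D $$ (k mod dim_row D, ?j2)))"
    using ij assms by (simp add: scalar_prod_def index_kron atLeast0LessThan)
  also have "\<dots> = (\<Sum>k<dim_row C. \<Sum>l<dim_row D. (A $$ (?i1, k) * B $$ (?i2, l)) * (C $$ (k, ?j1) * D $$ (l, ?j2)))"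
    by (rule sum_divmod)
  also have "\<dots> = (\<Sum>k<dim_row C. A $$ (?i1, k) * C $$ (k, ?j1)) * (\<Sum>l<dim_row D. B $$ (?i2, l) * D $$ (l, ?j2))"
    by (simp add: sum_product mult_ac)
  also have "\<dots> = kron (A * C) (B * D) $$ (i, j)"
    using ij lt assms by (simp add: index_kron scalar_prod_def atLeast0LessThan)
  finally show "(kron A B * kron C D) $$ (i, j) = kron (A * C) (B * D) $$ (i, j)" .
qed simp_all

lemma kron_smult:
  fixes A :: "'a::comm_semiring_0 Matrix.mat"
  shows "kron (c \<cdot>\<^sub>m A) (d \<cdot>\<^sub>m B) = (c * d) \<cdot>\<^sub>m kron A B"
proof (rule eq_matI)
  fix i j assume "i < dim_row ((c * d) \<cdot>\<^sub>m kron A B)" "j < dim_col ((c * d) \<cdot>\<^sub>m kron A B)"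
  then have ij: "i < dim_row A * dim_row B" "j < dim_col A * dim_col B" by simp_all
  then have pos: "dim_row B > 0" "dim_col B > 0" by (auto intro!: gr0I)
  with ij show "kron (c \<cdot>\<^sub>m A) (d \<cdot>\<^sub>m B) $$ (i, j) = ((c * d) \<cdot>\<^sub>m kron A B) $$ (i, j)"
    by (simp add: index_kron less_mult_imp_div_less mult_ac)
qed simp_all

text \<open>Together with its qubit version this shows that no Pauli operator vanishes, which makes
  an eigenvalue unique.\<close>

lemma kron_entry_nonzero:
  fixes A :: "'a::semiring_no_zero_divisors Matrix.mat"
  assumes "\<exists>i<dim_row A. \<exists>j<dim_col A. A $$ (i, j) \<noteq> 0"
    and "\<exists>i<dim_row B. \<exists>j<dim_col B. B $$ (i, j) \<noteq> 0"
  shows "\<exists>i<dim_row (kron A B). \<exists>j<dim_col (kron A B). kron A B $$ (i, j) \<noteq> 0"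
proof -
  obtain i j k l where *: "i < dim_row A" "j < dim_col A" "A $$ (i, j) \<noteq> 0"
    "k < dim_row B" "l < dim_col B" "B $$ (k, l) \<noteq> 0"
    using assms by blast
  have less: "i * v + k < s * v" if "i < s" "k < v" for i k s v :: nat
  proof -
    have "i * v + k < (i + 1) * v" using that by simp
    also have "\<dots> \<le> s * v" using that by (intro mult_right_mono) auto
    finally show ?thesis .
  qed
  show ?thesis
    by (rule exI[of _ "i * dim_row B + k"], intro conjI exI[of _ "j * dim_col B + l"])
       (use * in \<open>auto simp: index_kron less\<close>)
qed

definition qubit_op :: "nat \<Rightarrow> nat \<Rightarrow> complex Matrix.mat" where
  "qubit_op x z = \<i> ^ (x * z) \<cdot>\<^sub>m (pauli_X ^\<^sub>m x * pauli_Z ^\<^sub>m z)"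

abbreviation mat2 :: "'a \<Rightarrow> 'a \<Rightarrow> 'a \<Rightarrow> 'a \<Rightarrow> 'a Matrix.mat" where
  "mat2 a b c d \<equiv> mat_of_rows_list 2 [[a, b], [c, d]]"

lemma mat2_mult:
  fixes a :: "'a::comm_semiring_0"
  shows "mat2 a b c d * mat2 a' b' c' d' =
    mat2 (a * a' + b * c') (a * b' + b * d') (c * a' + d * c') (c * b' + d * d')"
  by (rule eq_matI)
     (auto simp: mat_of_rows_list_def scalar_prod_def less_Suc_eq numeral_2_eq_2)

lemma mat2_smult: "k \<cdot>\<^sub>m mat2 a b c d = mat2 (k * a) (k * b) (k * c) (k * d)"
  by (rule eq_matI) (auto simp: mat_of_rows_list_def less_Suc_eq numeral_2_eq_2)

text \<open>The matrices I, X, Z and Y; the phase in \<open>qubit_op\<close> makes the last one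
  Hermitian.\<close>

lemma qubit_op_eq:
  "qubit_op 0 0 = mat_of_rows_list 2 [[1, 0], [0, 1]]"
  "qubit_op 1 0 = mat_of_rows_list 2 [[0, 1], [1, 0]]"
  "qubit_op 0 1 = mat_of_rows_list 2 [[1, 0], [0, -1]]"
  "qubit_op 1 1 = mat_of_rows_list 2 [[0, -\<i>], [\<i>, 0]]"
  by (auto intro!: eq_matI simp: qubit_op_def pauli_X_def pauli_Z_def mat_of_rows_list_def
    scalar_prod_def less_Suc_eq numeral_2_eq_2)

lemma dim_qubit_op [simp]:
  assumes "x \<le> 1" "z \<le> 1"
  shows "dim_row (qubit_op x z) = 2" "dim_col (qubit_op x z) = 2"
  using assms by (auto simp: qubit_op_eq qubit_op_eq[simplified] le_Suc_eq mat_of_rows_list_def)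

text \<open>Each one-qubit Pauli matrix squares to the identity, and two of them commute or
  anticommute according to the parity of the exponent. The sixteen cases are multiplied out.\<close>

lemma qubit_op_conj:
  assumes "x \<le> 1" "z \<le> 1" "x' \<le> 1" "z' \<le> 1"
  shows "qubit_op x' z' * qubit_op x z * qubit_op x' z' =
    (-1) ^ (x' * z + z' * x) \<cdot>\<^sub>m qubit_op x z"
proof -
  have "x = 0 \<or> x = 1" "z = 0 \<or> z = 1" "x' = 0 \<or> x' = 1" "z' = 0 \<or> z' = 1"
    using assms by auto
  then show ?thesis
    by (elim disjE; simp add: qubit_op_eq qubit_op_eq[simplified] mat2_mult mat2_smult)
qed

lemma qubit_op_entry_nonzero:
  assumes "x \<le> 1" "z \<le> 1"
  shows "\<exists>i<dim_row (qubit_op x z). \<exists>j<dim_col (qubit_op x z). qubit_op x z $$ (i, j) \<noteq> 0"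
proof -
  have "x = 0 \<or> x = 1" "z = 0 \<or> z = 1" using assms by auto
  \<comment> \<open>A factor X moves the nonzero entry of row 0 off the diagonal, into column
    1.\<close>
  then have "qubit_op x z $$ (0, x) \<noteq> 0"
    by (elim disjE) (simp_all add: qubit_op_eq qubit_op_eq[simplified] mat_of_rows_list_def)
  with assms show ?thesis
    by (intro exI[of _ 0] exI[of _ x] conjI) auto
qed

text \<open>The qubits form an arbitrary list, so that induction can remove tensor factors while
  \<open>n\<close>, which locates the bits, stays fixed.\<close>

definition pauli_string :: "nat \<Rightarrow> nat \<Rightarrow> nat list \<Rightarrow> complex Matrix.mat" where
  "pauli_string n a ks = foldr kron (map (\<lambda>k. qubit_op (xbit n a k) (zbit n a k)) ks) (1\<^sub>m 1)"

lemma pauli_op_eq_pauli_string: "pauli_op n a = pauli_string n a [1..<n + 1]"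
  by (simp add: pauli_op_def pauli_string_def qubit_op_def)

lemma xbit_le_1 [simp]: "xbit n a k \<le> Suc 0" and zbit_le_1 [simp]: "zbit n a k \<le> Suc 0"
  by (simp_all add: xbit_def zbit_def)

lemma dim_pauli_string [simp]:
  "dim_row (pauli_string n a ks) = 2 ^ length ks" "dim_col (pauli_string n a ks) = 2 ^ length ks"
  by (induction ks) (simp_all add: pauli_string_def)

lemma pauli_string_conj:
  "pauli_string n b ks * pauli_string n a ks * pauli_string n b ks =
    (-1) ^ (\<Sum>k\<leftarrow>ks. xbit n b k * zbit n a k + zbit n b k * xbit n a k) \<cdot>\<^sub>m pauli_string n a ks"
proof (induction ks)
  case Nil
  show ?case by (auto simp: pauli_string_def)
next
  case (Cons k ks)
  have *: "pauli_string n c (k # ks) = kron (qubit_op (xbit n c k) (zbit n c k)) (pauli_string n c ks)" for c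
    by (simp add: pauli_string_def)
  show ?case
    by (simp add: * kron_mult Cons.IH qubit_op_conj kron_smult power_add)
qed

lemma pauli_string_entry_nonzero:
  "\<exists>i<2 ^ length ks. \<exists>j<2 ^ length ks. pauli_string n a ks $$ (i, j) \<noteq> 0"
proof (induction ks)
  case Nil
  show ?case by (auto simp: pauli_string_def)
next
  case (Cons k ks)
  have "pauli_string n a (k # ks) = kron (qubit_op (xbit n a k) (zbit n a k)) (pauli_string n a ks)"
    by (simp add: pauli_string_def)
  then show ?case
    using kron_entry_nonzero[of "qubit_op (xbit n a k) (zbit n a k)" "pauli_string n a ks"]
      Cons.IH qubit_op_entry_nonzero[of "xbit n a k" "zbit n a k"]
    by simp
qed

lemma pauli_op_conj:
  "pauli_op n b * pauli_op n a * pauli_op n b = complex_of_real (chi n b a) \<cdot>\<^sub>m pauli_op n a"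
proof -
  have "(\<Sum>k\<leftarrow>[1..<n+1]. xbit n b k * zbit n a k + zbit n b k * xbit n a k) = symp n b a"
    unfolding symp_def
    by (subst interv_sum_list_conv_sum_set_nat)
       (simp only: set_upt Suc_eq_plus1[symmetric] atLeastLessThanSuc_atLeastAtMost)
  then show ?thesis
    by (simp add: pauli_op_eq_pauli_string pauli_string_conj chi_def)
qed

lemma dim_pauli_op [simp]: "dim_row (pauli_op n a) = 2 ^ n" "dim_col (pauli_op n a) = 2 ^ n"
  by (simp_all add: pauli_op_eq_pauli_string)

lemma pauli_channel_pauli_op:
  "pauli_channel n p (pauli_op n a) =
    complex_of_real (\<Sum>b<4^n. chi n a b * p b) \<cdot>\<^sub>m pauli_op n a"
  by (rule eq_matI)
     (simp_all add: pauli_channel_def pauli_op_conj sum_distrib_left chi_commute[of n a] mult_ac)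

text \<open>Each error term conjugates a Pauli operator into a signed copy of itself, so the channel
  scales it by the character transform of \<open>p\<close>. A nonzero entry of the operator then
  identifies the scalar.\<close>

lemma pauli_eigenvalues_iff:
  "pauli_eigenvalues n p l \<longleftrightarrow> (\<forall>a<4^n. l a = (\<Sum>b<4^n. chi n a b * p b))"
proof -
  have inj: "c \<cdot>\<^sub>m pauli_op n a = d \<cdot>\<^sub>m pauli_op n a \<longleftrightarrow> c = d" for a c d
  proof
    assume eq: "c \<cdot>\<^sub>m pauli_op n a = d \<cdot>\<^sub>m pauli_op n a"
    obtain i j where ij: "i < 2 ^ n" "j < 2 ^ n" "pauli_op n a $$ (i, j) \<noteq> 0"
      using pauli_string_entry_nonzero[of "[1..<n+1]" n a]
      unfolding pauli_op_eq_pauli_string[symmetric] by (auto simp del: upt_Suc)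
    have "(c \<cdot>\<^sub>m pauli_op n a) $$ (i, j) = (d \<cdot>\<^sub>m pauli_op n a) $$ (i, j)"
      by (simp only: eq)
    with ij show "c = d" by simp
  qed simp
  then show ?thesis
    unfolding pauli_eigenvalues_def pauli_channel_pauli_op inj of_real_eq_iff by auto
qed

section \<open>The Lambert function and Gaussian tails\<close>

lemma lambert_W0_pos:
  assumes "y > 0"
  shows "lambert_W0 y > 0" "lambert_W0 y * exp (lambert_W0 y) = y"
proof -
  \<comment> \<open>Only the larger argument has to be positive, so uniqueness also excludes the
    nonpositive candidates that the definition admits.\<close>
  have mono: "u * exp u < w * exp w" if "0 < w" "u < w" for u w :: real
  proof (cases "u > 0")
    case True
    with that show ?thesis by (intro mult_strict_mono) auto
  next
    case False
    then have "u * exp u \<le> 0" by (simp add: mult_le_0_iff)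
    with that show ?thesis by (smt (verit) exp_gt_zero mult_pos_pos)
  qed
  have "\<exists>w\<ge>0. w \<le> y \<and> w * exp w = y"
    by (rule IVT) (use assms in \<open>auto intro!: continuous_intros\<close>)
  then obtain w where w: "w \<ge> 0" "w * exp w = y" by auto
  with assms have "w > 0" by (cases "w = 0") auto
  have "lambert_W0 y = w"
    unfolding lambert_W0_def
  proof (rule the_equality)
    show "u = w" if "u \<ge> -1 \<and> u * exp u = y" for u
    proof (rule linorder_cases[of u w])
      assume "u < w"
      with mono[OF \<open>w > 0\<close>] that w show ?thesis by force
    next
      assume "w < u"
      with mono[of u w] \<open>w > 0\<close> that w show ?thesis by force
    qed
  qed (use w in auto)
  with w \<open>w > 0\<close> show "lambert_W0 y > 0" "lambert_W0 y * exp (lambert_W0 y) = y" by auto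
qed

lemma less_lambert_W0:
  assumes "c \<ge> 0" "c * exp c < y"
  shows "c < lambert_W0 y"
proof (rule ccontr)
  assume "\<not> c < lambert_W0 y"
  moreover have "y > 0" using assms by (meson exp_ge_zero mult_nonneg_nonneg order_le_less_trans)
  note W = lambert_W0_pos[OF this]
  ultimately have "lambert_W0 y * exp (lambert_W0 y) \<le> c * exp c"
    by (intro mult_mono) auto
  with W assms show False by simp
qed

text \<open>In Machin's formula, \<open>arctan (1 / 5) \<le> 1 / 5\<close> and a nonnegative
  subtracted term give \<open>pi / 4 \<le> 4 / 5\<close>.\<close>

lemma pi_le_16_5: "pi \<le> 16 / 5"
proof -
  have "arctan (1 / 239) \<ge> 0" by simp
  moreover have "arctan (1 / 5) \<le> 1 / 5" by (rule arctan_le_self) simp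
  ultimately show ?thesis using machin by linarith
qed

text \<open>The numerical core of the upper bound, applied to \<open>u = sqrt W\<close>. The
  constant \<open>128\<close> is \<open>8 * N\<^sup>2\<close> at the smallest dimension
  \<open>N = 4\<close>.\<close>

lemma exp_mult_square_le:
  fixes u :: real
  assumes "u > 0"
  shows "u\<^sup>2 * exp (u\<^sup>2) * exp (- (2 * (u - 1)\<^sup>2)) \<le> 128 / pi"
proof -
  \<comment> \<open>The tangent bound, sharp at \<open>u = 2\<close>, turns \<open>u\<^sup>2\<close>
    into an exponential; the total exponent is then a concave quadratic with maximum
    \<open>9 / 4\<close>.\<close>
  have "u / 2 \<le> exp (u / 2 - 1)"
    using exp_ge_add_one_self[of "u / 2 - 1"] by simp
  then have "(u / 2)\<^sup>2 \<le> (exp (u / 2 - 1))\<^sup>2"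
    using assms by (intro power_mono) auto
  then have "u\<^sup>2 \<le> 4 * exp (u - 2)"
    by (simp add: power_divide exp_double[symmetric] algebra_simps)
  then have "u\<^sup>2 * exp (u\<^sup>2) * exp (- (2 * (u - 1)\<^sup>2)) \<le>
      4 * exp (u - 2) * exp (u\<^sup>2) * exp (- (2 * (u - 1)\<^sup>2))"
    by (intro mult_right_mono) auto
  also have "\<dots> = 4 * exp (9 / 4 - (u - 5 / 2)\<^sup>2)"
    by (simp add: exp_add[symmetric] power2_eq_square algebra_simps)
  also have "\<dots> \<le> 4 * exp (9 / 4)" by simp
  \<comment> \<open>Compared through fourth powers, where \<open>exp 9\<close> is bounded by
    \<open>2.72 ^ 9\<close>.\<close>
  also have "exp (9 / 4) \<le> (10 :: real)"
  proof (rule power_le_imp_le_base)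
    have "exp (9 / 4 :: real) ^ Suc 3 = exp 1 ^ 9"
      by (simp add: exp_of_nat_mult[symmetric])
    also have "\<dots> \<le> (272 / 100) ^ 9"
      using e_less_272 by (intro power_mono) auto
    also have "\<dots> \<le> 10 ^ Suc 3" by (simp add: power_divide)
    finally show "exp (9 / 4 :: real) ^ Suc 3 \<le> 10 ^ Suc 3" .
  qed simp
  also have "4 * (10::real) \<le> 128 / pi"
    using pi_le_16_5 by (simp add: field_simps)
  finally show ?thesis by simp
qed

text \<open>The defining equation makes \<open>W * exp W\<close> at least
  \<open>128 / (pi * \<delta>\<^sup>2)\<close>, and \<open>exp_mult_square_le\<close> converts this
  into the claim at \<open>t = W\<close>. Since \<open>W > 1\<close>, the exponent only improves for
  larger \<open>t\<close>.\<close>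

lemma lambert_W0_concentration:
  fixes N \<delta> t :: real
  defines "W \<equiv> lambert_W0 (8 * N\<^sup>2 / (pi * \<delta>\<^sup>2))"
  assumes N: "N \<ge> 4" and \<delta>: "0 < \<delta>" "\<delta> \<le> 1" and t: "t \<ge> W"
  shows "t \<ge> 1" "exp (- (sqrt t - 1)\<^sup>2) \<le> \<delta>"
proof -
  have "\<delta>\<^sup>2 \<le> 1" using \<delta> by (simp add: power_le_one)
  have N2: "N\<^sup>2 \<ge> 16" using power_mono[OF N, of 2] by simp
  have pos: "8 * N\<^sup>2 / (pi * \<delta>\<^sup>2) > 0" using N \<delta> by simp
  note W = lambert_W0_pos[OF pos, folded W_def]
  have "40 \<le> 128 / pi" using pi_le_16_5 by (simp add: field_simps)
  also have "128 / pi \<le> 128 / (pi * \<delta>\<^sup>2)"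
    using \<delta> \<open>\<delta>\<^sup>2 \<le> 1\<close> by (intro divide_left_mono) auto
  also have "\<dots> \<le> 8 * N\<^sup>2 / (pi * \<delta>\<^sup>2)"
    using \<delta> N2 by (intro divide_right_mono) auto
  finally have "1 * exp 1 < 8 * N\<^sup>2 / (pi * \<delta>\<^sup>2)"
    using e_less_272 by simp
  then have W1: "W > 1" unfolding W_def by (rule less_lambert_W0[rotated]) simp
  with t show "t \<ge> 1" by simp
  define u where "u = sqrt W"
  have u: "u > 1" "u\<^sup>2 = W" using W1 by (auto simp: u_def)
  have "128 / pi / \<delta>\<^sup>2 \<le> u\<^sup>2 * exp (u\<^sup>2)"
    using \<delta> N2 by (simp add: u W) (intro divide_right_mono, auto)
  then have "128 / pi / \<delta>\<^sup>2 * exp (- (2 * (u - 1)\<^sup>2)) \<le> u\<^sup>2 * exp (u\<^sup>2) * exp (- (2 * (u - 1)\<^sup>2))"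
    by (intro mult_right_mono) auto
  also have "\<dots> \<le> 128 / pi"
    using u by (intro exp_mult_square_le) auto
  finally have "exp (- (2 * (u - 1)\<^sup>2)) \<le> \<delta>\<^sup>2"
    using \<delta> by (simp add: field_simps)
  also have "exp (- (2 * (u - 1)\<^sup>2)) = (exp (- (u - 1)\<^sup>2))\<^sup>2"
    by (simp add: exp_double[symmetric])
  finally have "exp (- (u - 1)\<^sup>2) \<le> \<delta>"
    using \<delta> by (simp add: power2_le_iff_abs_le)
  moreover have "(u - 1)\<^sup>2 \<le> (sqrt t - 1)\<^sup>2"
    using u t by (intro power_mono) (auto simp: u_def)
  then have "exp (- (sqrt t - 1)\<^sup>2) \<le> exp (- (u - 1)\<^sup>2)" by simp
  ultimately show "exp (- (sqrt t - 1)\<^sup>2) \<le> \<delta>" by linarith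
qed

section \<open>Gaussian tails and the central limit theorem for fair signs\<close>

text \<open>The bound is the integral of the derivative of \<open>F\<close>, which is the density
  times \<open>1 - 2 / (1 + y\<^sup>2)\<^sup>2\<close> and hence lies below the density. From
  \<open>1\<close> on this factor is nonnegative, as the improper integral requires.\<close>

lemma std_normal_tail_ge:
  assumes x: "x \<ge> 1"
  shows "measure std_normal_distribution {x..} \<ge> std_normal_density x * (x / (1 + x\<^sup>2))"
proof -
  interpret real_distribution std_normal_distribution
    by (rule real_dist_normal_dist)
  define F where "F y = - (std_normal_density y * (y / (1 + y\<^sup>2)))" for y
  define f where "f y = std_normal_density y * (1 - 2 / (1 + y\<^sup>2)\<^sup>2)" for y
  have ne: "1 + y * y \<noteq> 0" for y :: real by (metis add_nonneg_eq_0_iff zero_le_square zero_le_one zero_neq_one)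
  have "\<integral>\<^sup>+ y. ennreal (f y) * indicator {x..} y \<partial>lborel = ennreal (0 - F x)"
  proof (rule nn_integral_FTC_atLeast)
    show "f \<in> borel_measurable borel" unfolding f_def by measurable
    show "DERIV F y :> f y" if "x \<le> y" for y
    proof -
      let ?A = "1 + y\<^sup>2"
      have A: "?A \<noteq> 0" using ne[of y] by (simp add: power2_eq_square)
      have "DERIV std_normal_density y :> - y * std_normal_density y"
      proof -
        have "((\<lambda>y::real. exp (- y\<^sup>2 / 2)) has_real_derivative - y * exp (- y\<^sup>2 / 2)) (at y)"
          by (auto intro!: derivative_eq_intros)
        from DERIV_cmult[OF this, of "1 / sqrt (2 * pi)"] show ?thesis
          unfolding std_normal_density_def by simp
      qed
      moreover have "((\<lambda>y. y / (1 + y\<^sup>2)) has_real_derivative (?A - y * (2 * y)) / ?A\<^sup>2) (at y)"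
        using A by (auto intro!: derivative_eq_intros simp: power2_eq_square)
      ultimately have "DERIV F y :> - (- y * std_normal_density y * (y / ?A)
          + (?A - y * (2 * y)) / ?A\<^sup>2 * std_normal_density y)"
        unfolding F_def by (intro DERIV_minus DERIV_mult)
      also have "- (- y * std_normal_density y * (y / ?A) + (?A - y * (2 * y)) / ?A\<^sup>2 * std_normal_density y)
          = std_normal_density y * ((?A - 1) / ?A - (2 - ?A) / ?A\<^sup>2)"
        by (simp add: algebra_simps power2_eq_square)
      also have "(?A - 1) / ?A - (2 - ?A) / ?A\<^sup>2 = 1 - 2 / ?A\<^sup>2"
        using A by (simp add: divide_simps) (simp add: power2_eq_square algebra_simps)
      finally show ?thesis unfolding f_def .
    qed
    show "0 \<le> f y" if "x \<le> y" for y
    proof -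
      have "1 \<le> y\<^sup>2" using x that by (simp add: one_le_power)
      then have "2\<^sup>2 \<le> (1 + y\<^sup>2)\<^sup>2" by (intro power_mono) auto
      then show ?thesis unfolding f_def
        by (intro mult_nonneg_nonneg) (auto simp: divide_le_eq)
    qed
    show "(F \<longlongrightarrow> 0) at_top"
      unfolding F_def std_normal_density_def by real_asymp
  qed
  moreover have "\<integral>\<^sup>+ y. ennreal (f y) * indicator {x..} y \<partial>lborel \<le>
      \<integral>\<^sup>+ y. ennreal (std_normal_density y) * indicator {x..} y \<partial>lborel"
    unfolding f_def
    by (intro nn_integral_mono mult_right_mono ennreal_leI)
       (auto intro!: mult_left_le)
  moreover have "\<dots> = emeasure std_normal_distribution {x..}"
    by (subst emeasure_density) (auto)
  ultimately have "ennreal (0 - F x) \<le> ennreal (measure std_normal_distribution {x..})"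
    by (simp add: emeasure_eq_measure)
  then show ?thesis by (simp add: F_def)
qed

text \<open>For a sign \<open>h\<close>, \<open>iexp (c * h)\<close> is
  \<open>cos c + \<i> * sin c * h\<close>, which is affine in \<open>h\<close>; the mean of
  \<open>h\<close> is zero.\<close>

lemma fair_sign_char:
  fixes h :: "'a \<Rightarrow> real"
  assumes "finite (set_pmf q)" "\<And>x. h x = 1 \<or> h x = -1" "measure_pmf.expectation q h = 0"
  shows "measure_pmf.expectation q (\<lambda>x. iexp (c * h x)) = complex_of_real (cos c)"
proof -
  have int: "integrable (measure_pmf q) k" for k :: "'a \<Rightarrow> complex"
    using assms(1) by (rule integrable_measure_pmf_finite)
  have eq: "iexp (c * h x) = complex_of_real (cos c) + \<i> * complex_of_real (sin c) * complex_of_real (h x)" for x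
    using assms(2)[of x]
    by (auto simp: complex_eq_iff Re_exp Im_exp)
  show ?thesis
    unfolding eq by (simp add: int assms(3))
qed

lemma tendsto_cos_power: "(\<lambda>m::nat. cos (t / sqrt m) ^ m) \<longlonglongrightarrow> exp (- t\<^sup>2 / 2)"
proof (cases "t = 0")
  case False
  then consider "t > 0" | "t < 0" by linarith
  then show ?thesis by cases (real_asymp simp: power2_eq_square)+
qed auto

text \<open>The underlying measure changes with \<open>m\<close>, so convergence is shown on
  characteristic functions: by independence they are \<open>cos (t / sqrt m) ^ m\<close>.\<close>

lemma fair_sign_sum_weak_conv:
  fixes h :: "'a \<Rightarrow> real"
  assumes q: "finite (set_pmf q)" and h: "\<And>x. h x = 1 \<or> h x = -1" "measure_pmf.expectation q h = 0"
  shows "weak_conv_m (\<lambda>m::nat. distr (iid_pmf m d q) borel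
    (\<lambda>w. (\<Sum>i<m. h (w i)) / sqrt m)) std_normal_distribution"
proof (rule levy_continuity)
  show "real_distribution (distr (iid_pmf m d q) borel
    (\<lambda>w. (\<Sum>i<m. h (w i)) / sqrt m))" for m :: nat
    by (rule prob_space.real_distribution_distr[OF measure_pmf.prob_space_axioms]) simp
  show "real_distribution std_normal_distribution" by (rule real_dist_normal_dist)
  fix t
  have "char (distr (iid_pmf m d q) borel (\<lambda>w. (\<Sum>i<m. h (w i)) / sqrt m)) t =
      complex_of_real (cos (t / sqrt m) ^ m)" for m :: nat
  proof -
    let ?P = "iid_pmf m d q"
    have indep: "prob_space.indep_vars (measure_pmf ?P) (\<lambda>_. borel) (\<lambda>i w. h (w i) / sqrt m) {..<m}"
      by (rule prob_space.indep_vars_compose2[OF measure_pmf.prob_space_axioms indep_vars_Pi_pmf]) auto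
    have one: "char (distr ?P borel (\<lambda>w. h (w i) / sqrt m)) t = complex_of_real (cos (t / sqrt m))"
      if "i < m" for i
    proof -
      have "char (distr ?P borel (\<lambda>w. h (w i) / sqrt m)) t =
          measure_pmf.expectation (map_pmf (\<lambda>w. w i) ?P) (\<lambda>x. iexp ((t / sqrt m) * h x))"
        by (simp add: char_def integral_distr)
      also have "map_pmf (\<lambda>w. w i) ?P = q"
        using that by (simp add: Pi_pmf_component)
      finally show ?thesis by (simp only: fair_sign_char[OF q h])
    qed
    have "char (distr ?P borel (\<lambda>w. \<Sum>i<m. h (w i) / sqrt m)) t =
        (\<Prod>i<m. char (distr ?P borel (\<lambda>w. h (w i) / sqrt m)) t)"
      by (rule prob_space.char_distr_sum[OF measure_pmf.prob_space_axioms indep])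
    then show ?thesis by (simp add: one sum_divide_distrib)
  qed
  then show "(\<lambda>m::nat. char (distr (iid_pmf m d q) borel
      (\<lambda>w. (\<Sum>i<m. h (w i)) / sqrt m)) t) \<longlonglongrightarrow> char std_normal_distribution t"
    unfolding char_std_normal_distribution
    by (simp only: tendsto_of_real_iff tendsto_cos_power)
qed

text \<open>The normal law has no atom, so its distribution function is continuous at
  \<open>x\<close>, and open and closed half-lines have equal mass.\<close>

lemma fair_sign_sum_tail:
  fixes h :: "'a \<Rightarrow> real"
  assumes "finite (set_pmf q)" "\<And>x. h x = 1 \<or> h x = -1" "measure_pmf.expectation q h = 0"
  shows "(\<lambda>m::nat. measure_pmf.prob (iid_pmf m d q) {w. (\<Sum>i<m. h (w i)) / sqrt m > x})
    \<longlonglongrightarrow> measure std_normal_distribution {x..}"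
proof -
  let ?D = "\<lambda>m::nat. distr (iid_pmf m d q) borel (\<lambda>w. (\<Sum>i<m. h (w i)) / sqrt m)"
  interpret N: real_distribution std_normal_distribution
    by (rule real_dist_normal_dist)
  have null: "measure std_normal_distribution {x} = 0"
  proof -
    have "AE y in lborel. y \<noteq> x"
      by (rule AE_lborel_singleton)
    then have "emeasure std_normal_distribution {x} = 0"
      by (subst emeasure_density) (auto simp: nn_integral_0_iff_AE indicator_def elim!: eventually_mono)
    then show ?thesis by (simp add: measure_def)
  qed
  have tail: "measure M {x<..} = 1 - cdf M x" if "real_distribution M" for M
  proof -
    interpret real_distribution M by fact
    have "{x<..} = space M - {..x}" by auto
    moreover have "prob (space M - {..x}) = 1 - prob {..x}" by (rule prob_compl) simp
    ultimately show ?thesis by (simp only: cdf_def)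
  qed
  have D: "real_distribution (?D m)" for m
    by (rule prob_space.real_distribution_distr[OF measure_pmf.prob_space_axioms]) simp
  have "(\<lambda>m. cdf (?D m) x) \<longlonglongrightarrow> cdf std_normal_distribution x"
    using fair_sign_sum_weak_conv[OF assms] N.isCont_cdf[of x] null
    unfolding weak_conv_m_def weak_conv_def by blast
  then have "(\<lambda>m. 1 - cdf (?D m) x) \<longlonglongrightarrow> 1 - cdf std_normal_distribution x"
    by (intro tendsto_intros)
  moreover have "1 - cdf (?D m) x = measure_pmf.prob (iid_pmf m d q) {w. (\<Sum>i<m. h (w i)) / sqrt m > x}" for m :: nat
    by (subst tail[OF D, symmetric], subst measure_distr) (auto simp: vimage_def)
  moreover have "measure std_normal_distribution {x..} = 1 - cdf std_normal_distribution x"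
  proof -
    have "{x..} = {x} \<union> {x<..}" by auto
    then have "measure std_normal_distribution {x..} =
        measure std_normal_distribution {x} + measure std_normal_distribution {x<..}"
      by (simp only:) (rule N.finite_measure_Union, auto)
    then show ?thesis by (simp add: null tail[OF N.real_distribution_axioms])
  qed
  ultimately show ?thesis by simp
qed

section \<open>Learning Pauli eigenvalues\<close>

lemma param_space_iff:
  "l \<in> param_space n \<longleftrightarrow>
    (\<exists>p. (\<forall>a<4^n. p a > 0) \<and> (\<Sum>a<4^n. p a) = 1 \<and> (\<forall>a<4^n. l a = (\<Sum>b<4^n. chi n a b * p b)))"
  by (simp add: param_space_def pauli_eigenvalues_iff)

text \<open>The outcome formula inverts the transform from error rates to eigenvalues, so the
  outcomes follow the error rates. In particular the embedded function is a genuine mass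
  function.\<close>

lemma pmf_outcome_pmf:
  assumes p: "\<And>a. a < 4^n \<Longrightarrow> p a > 0" "(\<Sum>a<4^n. p a) = 1"
    and l: "\<And>a. a < 4^n \<Longrightarrow> l a = (\<Sum>b<4^n. chi n a b * p b)"
  shows "pmf (outcome_pmf n l) x = (if x < 4^n then p x else 0)"
proof -
  have prob: "outcome_prob n l x = p x" if "x < 4^n" for x
    using chi_inversion[OF that, of p] l by (simp add: outcome_prob_def chi_def mult.commute)
  let ?f = "\<lambda>x. if x < 4^n then outcome_prob n l x else 0"
  have nonneg: "?f x \<ge> 0" for x using p(1)[of x] by (simp add: prob order_less_imp_le)
  have "(\<integral>\<^sup>+ x. ennreal (?f x) \<partial>count_space UNIV) = (\<Sum>x<4^n. ennreal (?f x))"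
    by (rule nn_integral_count_space') (auto split: if_splits)
  also have "\<dots> = ennreal (\<Sum>x<4^n. ?f x)"
    by (intro sum_ennreal nonneg)
  also have "(\<Sum>x<4^n. ?f x) = 1" by (simp add: prob p(2))
  finally have "(\<integral>\<^sup>+ x. ennreal (?f x) \<partial>count_space UNIV) = 1" by simp
  from pmf_embed_pmf[of ?f x, OF nonneg this] show ?thesis
    unfolding outcome_pmf_def by (simp add: prob)
qed

lemma occurrences_eq_sum: "real (occurrences M w b) = (\<Sum>i<M. indicator {b} (w i))"
proof -
  have "{i. i < M \<and> w i = b} = {..<M} \<inter> {i. w i = b}" by auto
  then show ?thesis
    by (simp add: occurrences_def indicator_def sum.If_cases of_bool_def)
qed

definition freq_dev :: "(nat \<Rightarrow> real) \<Rightarrow> nat \<Rightarrow> (nat \<Rightarrow> nat) \<Rightarrow> nat \<Rightarrow> real" where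
  "freq_dev p M w b = real (occurrences M w b) / real M - p b"

lemma freq_dev_eq_sum:
  assumes "M > 0"
  shows "freq_dev p M w b = (\<Sum>i<M. indicator {b} (w i) - p b) / real M"
  using assms by (simp add: freq_dev_def occurrences_eq_sum sum_subtractf diff_divide_distrib)

lemma L2_set_ml_estimator:
  assumes M: "M > 0" and w: "\<And>i. i < M \<Longrightarrow> w i < 4^n"
    and p: "(\<Sum>a<4^n. p a) = 1"
    and l: "\<And>a. a < 4^n \<Longrightarrow> l a = (\<Sum>b<4^n. chi n a b * p b)"
  shows "L2_set (\<lambda>a. ml_estimator n M w a - l a) {1..4^n - 1} =
    2 ^ n * L2_set (freq_dev p M w) {..<4^n}"
proof -
  let ?D = "freq_dev p M w"
  have ml: "ml_estimator n M w a - l a = (\<Sum>b<4^n. chi n a b * ?D b)" if "a < 4^n" for a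
    using that by (simp add: ml_estimator_def l freq_dev_def chi_def sum_subtractf algebra_simps)
  have "(\<Sum>b<4^n. real (occurrences M w b)) = (\<Sum>i<M. \<Sum>b<4^n. indicator {b} (w i))"
    unfolding occurrences_eq_sum by (rule sum.swap)
  also have "\<dots> = (\<Sum>i<M. 1)"
    by (intro sum.cong refl) (simp add: indicator_def w of_bool_def)
  finally have "(\<Sum>b<4^n. real (occurrences M w b)) = M" by simp
  \<comment> \<open>Frequencies and rates both sum to one. Hence the coefficient at index
    \<open>0\<close>, absent from the estimation error, vanishes and Parseval over all indices gives
    an equality.\<close>
  then have zero: "(\<Sum>b<4^n. chi n 0 b * ?D b) = 0"
    using M p by (simp add: freq_dev_def sum_subtractf flip: sum_divide_distrib)
  have "{..<4^n} = insert 0 {1..4^n - (1::nat)}" by (auto simp: less_eq_Suc_le)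
  then have "(\<Sum>a\<in>{1..4^n - (1::nat)}. (\<Sum>b<4^n. chi n a b * ?D b)\<^sup>2) =
      (\<Sum>a<4^n. (\<Sum>b<4^n. chi n a b * ?D b)\<^sup>2)"
    using zero by simp
  also have "\<dots> = 4 ^ n * (\<Sum>b<4^n. (?D b)\<^sup>2)" by (rule chi_parseval)
  finally have "(\<Sum>a\<in>{1..4^n - (1::nat)}. (ml_estimator n M w a - l a)\<^sup>2) = 4 ^ n * (\<Sum>b<4^n. (?D b)\<^sup>2)"
    by (subst sum.cong[OF refl, of _ _ "\<lambda>a. (\<Sum>b<4^n. chi n a b * ?D b)\<^sup>2"])
       (auto simp: ml less_eq_Suc_le)
  moreover have "sqrt (4 ^ n) = 2 ^ n"
    by (simp add: real_sqrt_power)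
  ultimately show ?thesis by (simp add: L2_set_def real_sqrt_mult)
qed

section \<open>Concentration of the empirical frequencies and the upper bound\<close>

text \<open>Replacing one outcome moves mass \<open>1 / M\<close> between at most two frequencies, a
  shift of norm at most \<open>sqrt 2 / M\<close>; the triangle inequality does the rest.\<close>

lemma freq_dev_bounded_differences:
  assumes i: "i < M"
  shows "\<bar>L2_set (freq_dev p M (w(i := x))) {..<N} - L2_set (freq_dev p M (w(i := y))) {..<N}\<bar>
    \<le> sqrt 2 / M"
proof -
  have one: "L2_set (freq_dev p M (w(i := x))) {..<N} \<le>
    L2_set (freq_dev p M (w(i := y))) {..<N} + sqrt 2 / M" for x y
  proof -
    define e where "e b = (indicator {b} x - indicator {b} y) / real M" for b
    have upd: "real (occurrences M (w(i := z)) b) = indicator {b} z + (\<Sum>j\<in>{..<M}-{i}. indicator {b} (w j))" for z b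
      unfolding occurrences_eq_sum using i by (subst sum.remove[of _ i]) auto
    have split: "freq_dev p M (w(i := x)) = (\<lambda>b. freq_dev p M (w(i := y)) b + e b)"
      by (simp add: freq_dev_def upd e_def fun_eq_iff diff_divide_distrib add_divide_distrib)
    have "(\<Sum>b<N. (e b)\<^sup>2) \<le> 2 / (real M)\<^sup>2"
    proof -
      have "(\<Sum>b<N. (e b)\<^sup>2) \<le> (\<Sum>b<N. (indicator {b} x + indicator {b} y) / (real M)\<^sup>2)"
        by (intro sum_mono) (auto simp: e_def power_divide indicator_def)
      also have "\<dots> = ((\<Sum>b<N. indicator {b} x) + (\<Sum>b<N. indicator {b} y)) / (real M)\<^sup>2"
        by (simp add: sum_divide_distrib sum.distrib add_divide_distrib)
      also have "\<dots> \<le> 2 / (real M)\<^sup>2"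
        by (intro divide_right_mono) (auto simp: indicator_def of_bool_def)
      finally show ?thesis .
    qed
    then have "L2_set e {..<N} \<le> sqrt (2 / (real M)\<^sup>2)"
      unfolding L2_set_def by (rule real_sqrt_le_mono)
    then have "L2_set e {..<N} \<le> sqrt 2 / M" by (simp add: real_sqrt_divide)
    with L2_set_triangle_ineq[of "freq_dev p M (w(i := y))" e "{..<N}"] show ?thesis
      unfolding split by linarith
  qed
  from one[of x y] one[of y x] show ?thesis by linarith
qed

text \<open>Each frequency has variance at most \<open>p b / M\<close>, and these bounds add up to
  \<open>1 / M\<close> whatever the number of outcomes. The square root comes from the nonnegativity
  of the variance of the norm.\<close>

lemma expectation_freq_dev_le:
  assumes M: "M > 0" and q: "set_pmf q \<subseteq> {..<N}"
    and p: "\<And>b. b < N \<Longrightarrow> p b = pmf q b"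
  shows "measure_pmf.expectation (iid_pmf M d q) (\<lambda>w. L2_set (freq_dev p M w) {..<N})
    \<le> 1 / sqrt M"
proof -
  let ?P = "iid_pmf M d q"
  have fin: "finite (set_pmf q)" using q by (rule finite_subset) simp
  have finP: "finite (set_pmf ?P)" using fin by (intro finite_set_Pi_pmf) auto
  have int: "integrable (measure_pmf q) k" for k :: "nat \<Rightarrow> real"
    using fin by (rule integrable_measure_pmf_finite)
  have intP: "integrable (measure_pmf ?P) k" for k :: "_ \<Rightarrow> real"
    using finP by (rule integrable_measure_pmf_finite)
  have mean: "measure_pmf.expectation q (indicator {b}) = pmf q b" for b
    by (simp add: measure_pmf_single)
  have var: "measure_pmf.expectation q (\<lambda>x. (indicator {b} x - pmf q b)\<^sup>2) \<le> pmf q b" for b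
  proof -
    have "(indicator {b} x - pmf q b)\<^sup>2 = indicator {b} x * (1 - 2 * pmf q b) + (pmf q b)\<^sup>2" for x
      by (auto simp: indicator_def power2_eq_square algebra_simps)
    then have "measure_pmf.expectation q (\<lambda>x. (indicator {b} x - pmf q b)\<^sup>2) =
        pmf q b * (1 - 2 * pmf q b) + (pmf q b)\<^sup>2"
      by (simp add: int mean measure_pmf_single)
    also have "\<dots> \<le> pmf q b" by (simp add: power2_eq_square algebra_simps)
    finally show ?thesis .
  qed
  have "measure_pmf.expectation ?P (\<lambda>w. (L2_set (freq_dev p M w) {..<N})\<^sup>2) =
      (\<Sum>b<N. measure_pmf.expectation ?P (\<lambda>w. (freq_dev p M w b)\<^sup>2))"
    by (simp add: L2_set_def sum_nonneg intP)
  also have "\<dots> = (\<Sum>b<N. measure_pmf.expectation ?P (\<lambda>w. (\<Sum>i<M. indicator {b} (w i) - pmf q b)\<^sup>2) / (real M)\<^sup>2)"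
    by (intro sum.cong refl) (simp add: freq_dev_eq_sum[OF M] p power_divide)
  also have "\<dots> = (\<Sum>b<N. real M * measure_pmf.expectation q (\<lambda>x. (indicator {b} x - pmf q b)\<^sup>2) / (real M)\<^sup>2)"
    by (subst expectation_square_sum_Pi_pmf[OF fin]) (simp_all add: int mean measure_pmf_single)
  also have "\<dots> \<le> (\<Sum>b<N. real M * pmf q b / (real M)\<^sup>2)"
    by (intro sum_mono divide_right_mono mult_left_mono var) auto
  also have "\<dots> = (\<Sum>b<N. pmf q b) / M"
    using M by (simp add: sum_divide_distrib power2_eq_square)
  also have "(\<Sum>b<N. pmf q b) = 1"
    using q by (intro sum_pmf_eq_1) auto
  finally have "sqrt (measure_pmf.expectation ?P (\<lambda>w. (L2_set (freq_dev p M w) {..<N})\<^sup>2)) \<le> sqrt (1 / M)"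
    by (intro real_sqrt_le_mono)
  with expectation_le_sqrt_expectation_square[OF finP, of "\<lambda>w. L2_set (freq_dev p M w) {..<N}"]
  show ?thesis by (simp add: real_sqrt_divide)
qed

lemma freq_dev_tail:
  assumes M: "M > 0" and q: "set_pmf q \<subseteq> {..<N}"
    and p: "\<And>b. b < N \<Longrightarrow> p b = pmf q b" and r: "r \<ge> 1 / sqrt M"
  shows "measure_pmf.prob (iid_pmf M d q) {w. L2_set (freq_dev p M w) {..<N} > r}
    \<le> exp (- (sqrt M * r - 1)\<^sup>2)"
proof -
  let ?P = "iid_pmf M d q"
  let ?f = "\<lambda>w. L2_set (freq_dev p M w) {..<N}"
  let ?\<mu> = "measure_pmf.expectation ?P ?f"
  have fin: "finite (set_pmf q)" using q by (rule finite_subset) simp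
  have \<mu>: "?\<mu> \<le> 1 / sqrt M" using expectation_freq_dev_le[OF M q p] by simp
  \<comment> \<open>With differences \<open>sqrt 2 / M\<close> the exponent becomes
    \<open>- M * (r - \<mu>)\<^sup>2\<close>; the mean is then replaced by its bound
    \<open>1 / sqrt M\<close>, which does not exceed \<open>r\<close>.\<close>
  have "measure_pmf.prob ?P {w. ?f w > ?\<mu> + (r - ?\<mu>)} \<le> exp (- 2 * (r - ?\<mu>)\<^sup>2 / (real M * (sqrt 2 / M)\<^sup>2))"
    by (rule mcdiarmid_Pi_pmf[OF fin M])
       (use M \<mu> r freq_dev_bounded_differences in auto)
  also have "- 2 * (r - ?\<mu>)\<^sup>2 / (real M * (sqrt 2 / M)\<^sup>2) = - (sqrt M * (r - ?\<mu>))\<^sup>2"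
    using M by (simp add: power_divide power_mult_distrib power2_eq_square[of "real M"])
  also have "exp (- (sqrt M * (r - ?\<mu>))\<^sup>2) \<le> exp (- (sqrt M * r - 1)\<^sup>2)"
  proof -
    have "sqrt M * (r - 1 / sqrt M) \<le> sqrt M * (r - ?\<mu>)"
      using \<mu> by (intro mult_left_mono) auto
    moreover have "sqrt M * (r - 1 / sqrt M) = sqrt M * r - 1"
      using M by (simp add: algebra_simps)
    moreover have "sqrt M * (1 / sqrt M) \<le> sqrt M * r"
      using r by (intro mult_left_mono) auto
    ultimately have "(sqrt M * r - 1)\<^sup>2 \<le> (sqrt M * (r - ?\<mu>))\<^sup>2"
      using M by (intro power_mono) auto
    then show ?thesis by simp
  qed
  finally show ?thesis by simp
qed

lemma iid_pmf_value_less: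
  assumes "set_pmf q \<subseteq> {..<N}" "w \<in> set_pmf (iid_pmf M d q)" "i < M"
  shows "w i < N"
  using assms by (auto simp: set_Pi_pmf PiE_dflt_def)

lemma success_prob_eq:
  assumes p: "\<And>a. a < 4^n \<Longrightarrow> p a > 0" "(\<Sum>a<4^n. p a) = 1"
    and l: "\<And>a. a < 4^n \<Longrightarrow> l a = (\<Sum>b<4^n. chi n a b * p b)"
    and M: "M > 0"
  shows "success_prob n l M \<epsilon> =
    1 - measure_pmf.prob (iid_pmf M 0 (outcome_pmf n l))
      {w. L2_set (freq_dev p M w) {..<4^n} > \<epsilon> / 2 ^ n}"
proof -
  let ?q = "outcome_pmf n l"
  let ?P = "iid_pmf M 0 ?q"
  let ?B = "{w. L2_set (freq_dev p M w) {..<4^n} > \<epsilon> / 2 ^ n}"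
  have set: "set_pmf ?q \<subseteq> {..<4^n}"
    by (auto simp: set_pmf_iff pmf_outcome_pmf[OF p l] split: if_splits)
  have "success_prob n l M \<epsilon> = measure_pmf.prob ?P (- ?B)"
    unfolding success_prob_def repetitions_pmf_def
  \<comment> \<open>The norm identity requires all outcomes to lie below \<open>4 ^ n\<close>, so
    the events agree on the support only.\<close>
  proof (rule measure_pmf.finite_measure_eq_AE)
    show "AE w in ?P. (w \<in> {w. L2_set (\<lambda>a. ml_estimator n M w a - l a) {1..4 ^ n - 1} \<le> \<epsilon>}) = (w \<in> - ?B)"
      unfolding AE_measure_pmf_iff
    proof
      fix w assume w: "w \<in> set_pmf ?P"
      show "(w \<in> {w. L2_set (\<lambda>a. ml_estimator n M w a - l a) {1..4 ^ n - 1} \<le> \<epsilon>}) = (w \<in> - ?B)"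
        using L2_set_ml_estimator[OF M iid_pmf_value_less[OF set w] p(2) l]
        by (simp add: field_simps not_less)
    qed
  qed auto
  also have "\<dots> = 1 - measure_pmf.prob ?P ?B"
    using measure_pmf.prob_compl[of ?B ?P] by (simp add: Compl_eq_Diff_UNIV)
  finally show ?thesis .
qed

lemma success_prob_ge:
  assumes n: "n \<ge> 1" and \<delta>: "0 < \<delta>" "\<delta> \<le> 1" and \<epsilon>: "\<epsilon> > 0" and M: "M > 0"
    and t: "real M * \<epsilon>\<^sup>2 / 4 ^ n \<ge> lambert_W0 (8 * (4 ^ n)\<^sup>2 / (pi * \<delta>\<^sup>2))"
    and l: "l \<in> param_space n"
  shows "success_prob n l M \<epsilon> \<ge> 1 - \<delta>"
proof -
  obtain p where p: "\<And>a. a < 4^n \<Longrightarrow> p a > 0" "(\<Sum>a<4^n. p a) = 1"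
    and l: "\<And>a. a < 4^n \<Longrightarrow> l a = (\<Sum>b<4^n. chi n a b * p b)"
    using l unfolding param_space_iff by blast
  let ?q = "outcome_pmf n l"
  have set: "set_pmf ?q \<subseteq> {..<4^n}"
    by (auto simp: set_pmf_iff pmf_outcome_pmf[OF p l] split: if_splits)
  have N: "(4::real) \<le> 4 ^ n" using power_increasing[OF n, of "4::real"] by simp
  note W = lambert_W0_concentration[OF N \<delta> t]
  have "sqrt (4 ^ n) = 2 ^ n" by (simp add: real_sqrt_power)
  then have st: "sqrt (real M * \<epsilon>\<^sup>2 / 4 ^ n) = sqrt M * (\<epsilon> / 2 ^ n)"
    using \<epsilon> by (simp add: real_sqrt_mult real_sqrt_divide)
  have "1 \<le> sqrt M * (\<epsilon> / 2 ^ n)" using W(1) st by (metis real_sqrt_ge_1_iff)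
  then have "1 / sqrt M \<le> \<epsilon> / 2 ^ n"
    using M by (simp add: field_simps)
  then have "measure_pmf.prob (iid_pmf M 0 ?q)
      {w. L2_set (freq_dev p M w) {..<4^n} > \<epsilon> / 2 ^ n} \<le> exp (- (sqrt M * (\<epsilon> / 2 ^ n) - 1)\<^sup>2)"
    by (intro freq_dev_tail M set) (simp_all add: pmf_outcome_pmf[OF p l])
  also have "\<dots> \<le> \<delta>" using W(2) unfolding st .
  finally show ?thesis by (simp add: success_prob_eq[OF p l M])
qed

text \<open>Rounding up the threshold of \<open>success_prob_ge\<close> gives an admissible sample
  size and costs at most \<open>1\<close>. Its existence also means that \<open>LEAST\<close> is
  attained, so \<open>N_samp\<close> itself has the defining property.\<close>

lemma N_samp_upper:
  assumes n: "n \<ge> 1" and \<delta>: "0 < \<delta>" "\<delta> \<le> 1" and \<epsilon>: "\<epsilon> > 0"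
  defines "W \<equiv> lambert_W0 (8 * (4 ^ n)\<^sup>2 / (pi * \<delta>\<^sup>2))"
  shows "real (N_samp n \<delta> \<epsilon>) \<le> 4 ^ n * W / \<epsilon>\<^sup>2 + 1"
    and "\<And>M l. M \<ge> N_samp n \<delta> \<epsilon> \<Longrightarrow> l \<in> param_space n \<Longrightarrow> success_prob n l M \<epsilon> \<ge> 1 - \<delta>"
proof -
  have W: "W > 0" unfolding W_def using \<delta> by (intro lambert_W0_pos) auto
  define M0 where "M0 = nat \<lceil>4 ^ n * W / \<epsilon>\<^sup>2\<rceil>"
  have pos: "4 ^ n * W / \<epsilon>\<^sup>2 > 0" using W \<epsilon> by simp
  have M0: "M0 \<ge> 1" "4 ^ n * W / \<epsilon>\<^sup>2 \<le> M0" "M0 \<le> 4 ^ n * W / \<epsilon>\<^sup>2 + 1"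
    unfolding M0_def using pos by linarith+
  let ?Q = "\<lambda>M0. M0 \<ge> 1 \<and> (\<forall>M\<ge>M0. \<forall>l\<in>param_space n. success_prob n l M \<epsilon> \<ge> 1 - \<delta>)"
  have Q: "?Q M0"
  proof (intro conjI allI impI ballI)
    fix M l assume M: "M0 \<le> M" "l \<in> param_space n"
    then have "4 ^ n * W / \<epsilon>\<^sup>2 \<le> M" using M0 by linarith
    then have "real M * \<epsilon>\<^sup>2 / 4 ^ n \<ge> W" using \<epsilon> by (simp add: field_simps)
    with M M0 show "success_prob n l M \<epsilon> \<ge> 1 - \<delta>"
      unfolding W_def by (intro success_prob_ge[OF n \<delta> \<epsilon>]) auto
  qed (rule M0)
  have "N_samp n \<delta> \<epsilon> \<le> M0" unfolding N_samp_def by (rule Least_le) (rule Q)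
  with M0 show "real (N_samp n \<delta> \<epsilon>) \<le> 4 ^ n * W / \<epsilon>\<^sup>2 + 1" by linarith
  show "success_prob n l M \<epsilon> \<ge> 1 - \<delta>" if "M \<ge> N_samp n \<delta> \<epsilon>" "l \<in> param_space n" for M l
    using LeastI[of ?Q, OF Q] that unfolding N_samp_def by blast
qed

section \<open>The hard channel and the lower bound\<close>

text \<open>
  The hard channel gives the trivial outcome probability \<open>1/2\<close>, which maximises the variance
  of its relative frequency.
\<close>

lemma hard_channel:
  assumes n: "n \<ge> 1"
  obtains l where "l \<in> param_space n"
    "\<And>x. (\<lambda>M::nat. measure_pmf.prob (iid_pmf M 0 (outcome_pmf n l))
        {w. (\<Sum>i<M. if w i = 0 then 1 else -1) / sqrt M > x})
      \<longlonglongrightarrow> measure std_normal_distribution {x..}"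
    "\<And>(M::nat) \<epsilon>. M > 0 \<Longrightarrow> success_prob n l M \<epsilon> \<le>
      1 - measure_pmf.prob (iid_pmf M 0 (outcome_pmf n l))
        {w. (\<Sum>i<M. if w i = 0 then 1 else -1) / sqrt M > 2 * sqrt M * \<epsilon> / 2 ^ n}"
proof -
  define N :: nat where "N = 4 ^ n"
  have "N \<ge> 4 ^ 1" unfolding N_def using n by (intro power_increasing) auto
  then have N: "N > 1" by simp
  \<comment> \<open>The other half of the mass is spread evenly, keeping every rate positive as
    \<open>param_space\<close> demands.\<close>
  define p :: "nat \<Rightarrow> real" where "p a = (if a = 0 then 1 / 2 else 1 / (2 * (real N - 1)))" for a
  define l where "l a = (\<Sum>b<4^n. chi n a b * p b)" for a
  have ppos: "p a > 0" for a using N by (simp add: p_def)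
  have "{..<N} = insert 0 {1..<N}" using N by auto
  then have "(\<Sum>a<N. p a) = 1 / 2 + (\<Sum>a\<in>{1..<N}. p a)" by (simp add: p_def)
  also have "(\<Sum>a\<in>{1..<N}. p a) = (\<Sum>a\<in>{1..<N}. 1 / (2 * (real N - 1)))"
    by (intro sum.cong) (auto simp: p_def)
  also have "\<dots> = 1 / 2" using N by (simp add: of_nat_diff field_simps)
  finally have psum: "(\<Sum>a<4^n. p a) = 1" by (simp add: N_def)
  let ?q = "outcome_pmf n l"
  have pmf: "pmf ?q x = (if x < 4^n then p x else 0)" for x
    by (rule pmf_outcome_pmf) (simp_all add: ppos psum l_def)
  have set: "set_pmf ?q \<subseteq> {..<4^n}"
    by (auto simp: set_pmf_iff pmf split: if_splits)
  have fin: "finite (set_pmf ?q)" using set by (rule finite_subset) simp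
  let ?h = "\<lambda>x::nat. if x = 0 then 1 else -1 :: real"
  have "?h x = 2 * indicator {0} x - 1" for x by simp
  then have "measure_pmf.expectation ?q ?h = 2 * measure_pmf.prob ?q {0} - 1"
    using fin by (simp add: integrable_measure_pmf_finite)
  then have mean: "measure_pmf.expectation ?q ?h = 0"
    by (simp add: measure_pmf_single pmf p_def)
  show ?thesis
  proof (rule that)
    show "l \<in> param_space n"
      unfolding param_space_iff using ppos psum l_def by blast
    show "(\<lambda>M::nat. measure_pmf.prob (iid_pmf M 0 ?q) {w. (\<Sum>i<M. ?h (w i)) / sqrt M > x})
        \<longlonglongrightarrow> measure std_normal_distribution {x..}" for x
      by (rule fair_sign_sum_tail[OF fin _ mean]) auto
    fix M :: nat and \<epsilon> :: real assume M: "M > 0"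
    have "\<epsilon> / 2 ^ n < L2_set (freq_dev p M w) {..<4^n}"
      if "2 * sqrt M * \<epsilon> / 2 ^ n < (\<Sum>i<M. ?h (w i)) / sqrt M" for w
    proof -
      \<comment> \<open>The sign sum is \<open>2 * M\<close> times the deviation of the frequency of
        outcome \<open>0\<close>, one coordinate of the vector whose norm is to be bounded
        below.\<close>
      have "(\<Sum>i<M. ?h (w i)) = 2 * (\<Sum>i<M. indicator {0} (w i) - p 0)"
        unfolding sum_distrib_left by (intro sum.cong) (auto simp: p_def)
      also have "\<dots> = 2 * M * freq_dev p M w 0"
        using M by (simp add: freq_dev_eq_sum)
      finally have "2 * sqrt M * \<epsilon> / 2 ^ n < 2 * (M * freq_dev p M w 0) / sqrt M"
        using that by simp
      also have "\<dots> = 2 * sqrt M * freq_dev p M w 0"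
        using M by (simp add: field_simps flip: real_sqrt_mult)
      finally have "2 * sqrt M * (\<epsilon> / 2 ^ n) < 2 * sqrt M * freq_dev p M w 0" by simp
      then have "\<epsilon> / 2 ^ n < freq_dev p M w 0"
        using M by (subst (asm) mult_less_cancel_left_pos) auto
      also have "\<dots> \<le> \<bar>freq_dev p M w 0\<bar>" by simp
      also have "\<dots> \<le> L2_set (\<lambda>b. \<bar>freq_dev p M w b\<bar>) {..<4^n}"
        by (rule member_le_L2_set) auto
      finally show ?thesis by (simp add: L2_set_def)
    qed
    then show "success_prob n l M \<epsilon> \<le>
      1 - measure_pmf.prob (iid_pmf M 0 ?q)
        {w. (\<Sum>i<M. ?h (w i)) / sqrt M > 2 * sqrt M * \<epsilon> / 2 ^ n}"
      by (subst success_prob_eq[OF ppos psum l_def M])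
         (auto intro!: measure_pmf.finite_measure_mono)
  qed
qed

text \<open>\<open>N_samp\<close> demands success at every larger sample size, so a failure of one
  channel at a single \<open>M\<close> already forces
  \<open>M < N_samp n \<delta> \<epsilon>\<close>.\<close>

lemma N_samp_lower:
  assumes n: "n \<ge> 1" and \<delta>: "0 < \<delta>" "\<delta> < 1 / sqrt (8 * pi * exp 1)"
  defines "W \<equiv> lambert_W0 (1 / (8 * pi * \<delta>\<^sup>2))"
  shows "W > 0" "\<forall>\<^sub>F \<epsilon> in at_right 0. 4 ^ (n - 1) * W / \<epsilon>\<^sup>2 \<le> real (N_samp n \<delta> \<epsilon>)"
proof -
  \<comment> \<open>The condition on \<delta> says that the Lambert argument exceeds
    \<open>exp 1\<close>, that is, \<open>W > 1\<close>.\<close>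
  have \<delta>2: "\<delta>\<^sup>2 < 1 / (8 * pi * exp 1)"
    using power_strict_mono[OF \<delta>(2), of 2] \<delta>(1) by (simp add: power_divide)
  then have arg: "1 * exp 1 < 1 / (8 * pi * \<delta>\<^sup>2)"
    using \<delta>(1) by (simp add: field_simps)
  have W1: "W > 1" unfolding W_def by (rule less_lambert_W0[OF _ arg]) simp
  then show "W > 0" by simp
  have WW: "W * exp W = 1 / (8 * pi * \<delta>\<^sup>2)"
    unfolding W_def using \<delta>(1) by (intro lambert_W0_pos) auto
  have "1 \<le> 8 * pi * exp 1"
    using mult_mono[of 1 pi 1 "exp 1"] pi_ge_two by simp
  then have "1 / sqrt (8 * pi * exp 1) \<le> 1" by simp
  with \<delta> have \<delta>1: "\<delta> \<le> 1" by linarith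
  have tail: "\<delta> < measure std_normal_distribution {sqrt W..}"
  proof -
    have "\<delta>\<^sup>2 = 1 / (8 * pi * W * exp W)"
      using WW \<delta>(1) W1 by (simp add: field_simps)
    also have "\<dots> = (std_normal_density (sqrt W) * (1 / (2 * sqrt W)))\<^sup>2"
      using W1 by (simp add: std_normal_density_def power_mult_distrib power_divide exp_minus
          exp_double[symmetric] divide_simps)
    finally have "\<delta> = std_normal_density (sqrt W) * (1 / (2 * sqrt W))"
      using \<delta>(1) W1 by (subst (asm) power2_eq_iff_nonneg) auto
    \<comment> \<open>Equivalent to \<open>1 + W < 2 * W\<close>. Strictness leaves room for the
      error of the central limit theorem.\<close>
    also have "1 / (2 * sqrt W) < sqrt W / (1 + (sqrt W)\<^sup>2)"
      using W1 by (simp add: divide_simps mult.commute flip: mult.assoc)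
    then have "std_normal_density (sqrt W) * (1 / (2 * sqrt W)) <
        std_normal_density (sqrt W) * (sqrt W / (1 + (sqrt W)\<^sup>2))"
      by (intro mult_strict_left_mono) (auto simp: normal_density_pos)
    also have "\<dots> \<le> measure std_normal_distribution {sqrt W..}"
      using W1 by (intro std_normal_tail_ge) auto
    finally show ?thesis .
  qed
  obtain l where l: "l \<in> param_space n"
    and lim: "\<And>x. (\<lambda>M::nat. measure_pmf.prob (iid_pmf M 0 (outcome_pmf n l))
        {w. (\<Sum>i<M. if w i = 0 then 1 else -1) / sqrt M > x})
      \<longlonglongrightarrow> measure std_normal_distribution {x..}"
    and succ: "\<And>(M::nat) \<epsilon>. M > 0 \<Longrightarrow> success_prob n l M \<epsilon> \<le>
      1 - measure_pmf.prob (iid_pmf M 0 (outcome_pmf n l))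
        {w. (\<Sum>i<M. if w i = 0 then 1 else -1) / sqrt M > 2 * sqrt M * \<epsilon> / 2 ^ n}"
    using hard_channel[OF n] by blast
  have "\<forall>\<^sub>F M :: nat in sequentially. \<delta> < measure_pmf.prob (iid_pmf M 0 (outcome_pmf n l))
      {w. (\<Sum>i<M. if w i = 0 then 1 else -1) / sqrt M > sqrt W}"
    using order_tendstoD(1)[OF lim tail] W1 by simp
  then obtain K where K: "\<And>M::nat. M \<ge> K \<Longrightarrow> \<delta> < measure_pmf.prob (iid_pmf M 0 (outcome_pmf n l))
      {w. (\<Sum>i<M. if w i = 0 then 1 else -1) / sqrt M > sqrt W}"
    unfolding eventually_sequentially by blast
  have "filterlim (\<lambda>\<epsilon>. 4 ^ (n - 1) * W / \<epsilon>\<^sup>2) at_top (at_right 0)"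
    using \<open>W > 0\<close> by real_asymp
  \<comment> \<open>The extra \<open>1\<close> makes the floor both at least \<open>K\<close> and
    positive.\<close>
  then have "\<forall>\<^sub>F \<epsilon> in at_right 0. 4 ^ (n - 1) * W / \<epsilon>\<^sup>2 \<ge> real K + 1"
    by (simp add: filterlim_at_top)
  moreover have "\<forall>\<^sub>F \<epsilon> in at_right 0. \<epsilon> > (0::real)"
    by (rule eventually_at_right_less)
  ultimately show "\<forall>\<^sub>F \<epsilon> in at_right 0. 4 ^ (n - 1) * W / \<epsilon>\<^sup>2 \<le> real (N_samp n \<delta> \<epsilon>)"
  proof eventually_elim
    case (elim \<epsilon>)
    \<comment> \<open>Rounding down keeps the deviation threshold at most \<open>sqrt W\<close>. As
      \<open>N_samp\<close> is an integer exceeding \<open>M\<close>, it is at least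
      \<open>M + 1\<close> and nothing is lost.\<close>
    define M where "M = nat \<lfloor>4 ^ (n - 1) * W / \<epsilon>\<^sup>2\<rfloor>"
    have M: "M \<ge> K" "M > 0" "M \<le> 4 ^ (n - 1) * W / \<epsilon>\<^sup>2" "4 ^ (n - 1) * W / \<epsilon>\<^sup>2 < real M + 1"
      unfolding M_def using elim by linarith+
    have "(4::real) ^ n = 4 * 4 ^ (n - 1)" using n by (cases n) auto
    then have "4 * M * \<epsilon>\<^sup>2 / 4 ^ n \<le> W"
      using M(3) elim by (simp add: field_simps)
    moreover have "(2 * sqrt M * \<epsilon> / 2 ^ n)\<^sup>2 = 4 * M * \<epsilon>\<^sup>2 / 4 ^ n"
      by (simp add: power_mult_distrib power_divide power2_eq_square flip: power_mult_distrib)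
    ultimately have "2 * sqrt M * \<epsilon> / 2 ^ n \<le> sqrt W"
      by (intro real_le_rsqrt) simp
    then have "measure_pmf.prob (iid_pmf M 0 (outcome_pmf n l))
        {w. (\<Sum>i<M. if w i = 0 then 1 else -1) / sqrt M > sqrt W} \<le>
      measure_pmf.prob (iid_pmf M 0 (outcome_pmf n l))
        {w. (\<Sum>i<M. if w i = 0 then 1 else -1) / sqrt M > 2 * sqrt M * \<epsilon> / 2 ^ n}"
      by (intro measure_pmf.finite_measure_mono) auto
    with K[OF M(1)] succ[OF M(2), of \<epsilon>] have "success_prob n l M \<epsilon> < 1 - \<delta>" by linarith
    with N_samp_upper(2)[OF n \<delta>(1) \<delta>1, of \<epsilon> M l] elim l have "M < N_samp n \<delta> \<epsilon>"
      by (meson not_le)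
    with M(4) show ?case by linarith
  qed
qed

section \<open>Passage to the limit in \<epsilon>\<close>

theorem mainTheorem5:
  fixes n :: nat and \<delta> :: real
  assumes "n \<ge> 1"
  shows
    "(0 < \<delta> \<and> \<delta> \<le> 1 \<longrightarrow>
        Limsup (at_right 0) (\<lambda>\<epsilon>::real. ereal (real (N_samp n \<delta> \<epsilon>) /
          (4 ^ n * lambert_W0 (8 * pi powi (-1) * \<delta> powi (-2) * 4 ^ (2 * n)) * \<epsilon> powi (-2)))) \<le> 1)
     \<and>
     (0 < \<delta> \<and> \<delta> < 1 / sqrt (8 * pi * exp 1) \<longrightarrow>
        Liminf (at_right 0) (\<lambda>\<epsilon>::real. ereal (real (N_samp n \<delta> \<epsilon>) /
          (4 ^ (n - 1) * lambert_W0 (\<delta> powi (-2) / (8 * pi)) * \<epsilon> powi (-2)))) \<ge> 1)"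
proof (intro conjI impI)
  assume \<delta>: "0 < \<delta> \<and> \<delta> \<le> 1"
  define W where "W = lambert_W0 (8 * (4 ^ n)\<^sup>2 / (pi * \<delta>\<^sup>2))"
  have arg: "8 * pi powi (-1) * \<delta> powi (-2) * 4 ^ (2 * n) = 8 * (4 ^ n)\<^sup>2 / (pi * \<delta>\<^sup>2)"
    by (simp add: power_int_minus power_mult divide_inverse mult.commute flip: power_mult)
  have W: "W > 0" unfolding W_def using \<delta> by (intro lambert_W0_pos) auto
  have "\<forall>\<^sub>F \<epsilon> in at_right 0. \<epsilon> > (0::real)"
    by (rule eventually_at_right_less)
  \<comment> \<open>The \<open>1\<close> lost in rounding up becomes the relative error
    \<open>\<epsilon>\<^sup>2 / (4 ^ n * W)\<close>, which vanishes.\<close>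
  then have ev: "\<forall>\<^sub>F \<epsilon> in at_right 0. ereal (real (N_samp n \<delta> \<epsilon>) / (4 ^ n * W * \<epsilon> powi (-2))) \<le>
      ereal (1 + \<epsilon>\<^sup>2 / (4 ^ n * W))"
  proof eventually_elim
    case (elim \<epsilon>)
    then have "real (N_samp n \<delta> \<epsilon>) \<le> 4 ^ n * W / \<epsilon>\<^sup>2 + 1"
      unfolding W_def using assms \<delta> by (intro N_samp_upper) auto
    with elim W show ?case
      by (simp add: power_int_minus field_simps)
  qed
  have "((\<lambda>\<epsilon>. 1 + \<epsilon>\<^sup>2 / (4 ^ n * W)) \<longlongrightarrow> 1) (at_right 0)"
    by (rule tendsto_eq_intros refl | use W in simp)+
  then have "Limsup (at_right 0) (\<lambda>\<epsilon>. ereal (1 + \<epsilon>\<^sup>2 / (4 ^ n * W))) = 1"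
    by (intro lim_imp_Limsup) (simp_all add: one_ereal_def)
  with Limsup_mono[OF ev] have "Limsup (at_right 0) (\<lambda>\<epsilon>. ereal (real (N_samp n \<delta> \<epsilon>) / (4 ^ n * W * \<epsilon> powi (-2)))) \<le> 1"
    by (simp only:)
  then show "Limsup (at_right 0) (\<lambda>\<epsilon>::real. ereal (real (N_samp n \<delta> \<epsilon>) /
      (4 ^ n * lambert_W0 (8 * pi powi (-1) * \<delta> powi (-2) * 4 ^ (2 * n)) * \<epsilon> powi (-2)))) \<le> 1"
    unfolding arg W_def .
next
  assume \<delta>: "0 < \<delta> \<and> \<delta> < 1 / sqrt (8 * pi * exp 1)"
  define W where "W = lambert_W0 (1 / (8 * pi * \<delta>\<^sup>2))"
  have arg: "\<delta> powi (-2) / (8 * pi) = 1 / (8 * pi * \<delta>\<^sup>2)"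
    by (simp add: power_int_minus field_simps)
  have W: "W > 0" "\<forall>\<^sub>F \<epsilon> in at_right 0. 4 ^ (n - 1) * W / \<epsilon>\<^sup>2 \<le> real (N_samp n \<delta> \<epsilon>)"
    unfolding W_def using N_samp_lower[OF assms] \<delta> by auto
  have "\<forall>\<^sub>F \<epsilon> in at_right 0. \<epsilon> > (0::real)"
    by (rule eventually_at_right_less)
  with W(2) have "\<forall>\<^sub>F \<epsilon> in at_right 0. 1 \<le> ereal (real (N_samp n \<delta> \<epsilon>) / (4 ^ (n - 1) * W * \<epsilon> powi (-2)))"
  proof eventually_elim
    case (elim \<epsilon>)
    with W(1) show ?case by (simp add: power_int_minus field_simps)
  qed
  then show "Liminf (at_right 0) (\<lambda>\<epsilon>::real. ereal (real (N_samp n \<delta> \<epsilon>) /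
      (4 ^ (n - 1) * lambert_W0 (\<delta> powi (-2) / (8 * pi)) * \<epsilon> powi (-2)))) \<ge> 1"
    unfolding arg W_def by (rule Liminf_bounded)
qed

end
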